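(* Let $H=H(Q^1,Q^2,Q^3,Q^4)$ be the cubic graph constructed (as in the context) from cyclically $5$-edge connected permutation snarks $Q^1,\dots,Q^4$ with permutation $2$-factors $F^i$ not contained in any CDC of $Q^i$, and let $F$ be the associated permutation $2$-factor of $H$. If $S$ is a CDC of $H$, then $F\notin S$.
   Context: Basic notions. A circuit is a $2$-regular $2$-connected graph. A CDC of a graph $G$ is a set $S$ of subgraphs of $G$, every component of each of which is a circuit, such that every edge of $G$ lies in exactly two elements of $S$; a $2$-factor is contained in a CDC consisting of circuits if each of its circuits is an element of it (equivalently, there is a CDC in the general sense having the $2$-factor as an element). A cycle permutation graph is a cubic graph with a $2$-factor consisting of two chordless circuits (a permutation $2$-factor). A snark is a cyclically $4$-edge connected cubic graph of girth at least $5$ that is not $3$-edge colorable; a permutation snark is a cycle permutation graph that is a snark. $\lambda_c(G)$ is the minimum number of edges whose deletion yields two components each containing a circuit; cyclically $k$-edge connected means $\lambda_c\ge k$. The graphs $Q^i$ and $\widetilde Q^i$. For $i\in\{1,2,3,4\}$ let $Q^i$ be a cyclically $5$-edge connected permutation snark with a permutation $2$-factor $F^i$, with circuits $C^i_1,C^i_2$, such that $F^i$ is not contained in any CDC of $Q^i$. Label vertices so that $C^i_1$ contains a subpath with consecutive vertices $x^i_1,x^i_2,z^i_2,x^i_6$, and $C^i_2$ contains a subpath with consecutive vertices $x^i_4,z^i_1,x^i_5$, where $z^i_1z^i_2\in E(Q^i)$. Let $\widetilde Q^i$ be obtained from $Q^i$ by removing the edge $x^i_1x^i_2$ and the vertices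 $z^i_1,z^i_2$, and adding new vertices $y^i_1,\dots,y^i_6$ and edges $e^i_3:=x^i_2y^i_3$ and $e^i_s:=x^i_sy^i_s$ for $s=1,2,4,5,6$. The six edges $e^i_j$ together with the remaining edges of $F^i$ induce three paths in $\widetilde Q^i$: $A^i_1$ with end-edges $e^i_1,e^i_6$; $A^i_2$ with end-edges $e^i_4,e^i_5$; $A^i_3$ with end-edges $e^i_2,e^i_3$. Put $A^i:=A^i_1\cup A^i_2\cup A^i_3$. The graph $H$. In $\widetilde Q^1,\dots,\widetilde Q^4$ regard each $e^i_j$ as a half-edge (delete $y^i_j$), except $e^1_2,e^2_3,e^3_2,e^4_3$, which keep their degree-$1$ endvertices. $H$ is obtained from the disjoint union by gluing half-edges pairwise into single edges (gluing half-edges at $u$ and $v$ gives the edge $uv$): $e^1_1$ with $e^4_4$, $e^1_3$ with $e^4_5$; $e^4_1$ with $e^3_4$, $e^4_2$ with $e^3_5$; $e^3_1$ with $e^2_4$, $e^3_3$ with $e^2_5$; $e^2_1$ with $e^1_4$, $e^2_2$ with $e^1_5$; $e^1_6$ with $e^3_6$; $e^2_6$ with $e^4_6$; by identifying the degree-$1$ endvertices of $e^1_2$ and $e^3_2$ to one vertex $p$ and those of $e^2_3$ and $e^4_3$ to one vertex $q$; and by adding the edge $\alpha=pq$. Edge labels are kept, so an edge arising from two glued half-edges carries both labels. For each $i,j$, $A^i_j\subseteq H$ denotes the path in $H$ formed by all edges with the same labels as those of $A^i_j\subseteq\widetilde Q^i$ (including the full glued edges), and $A^i\subseteq H$ is the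 union of these three paths. $F:=A^1\cup A^2\cup A^3\cup A^4$ is a permutation $2$-factor of $H$ (consisting of two chordless circuits, not containing $\alpha$). *)

theory Defs
  imports Main "HOL-Library.Extended_Nat"
begin

section \<open>Finite simple graphs\<close>

datatype 'a graph = Graph (verts: "'a set") (edges: "'a set set")

definition simple_graph :: "'a graph \<Rightarrow> bool" where
  "simple_graph G \<longleftrightarrow>
     finite (verts G) \<and> (\<forall>e\<in>edges G. e \<subseteq> verts G \<and> card e = 2)"

definition subgraph :: "'a graph \<Rightarrow> 'a graph \<Rightarrow> bool" where
  "subgraph D G \<longleftrightarrow>
     verts D \<subseteq> verts G \<and> edges D \<subseteq> edges G \<and> (\<forall>e\<in>edges D. e \<subseteq> verts D)"

definition delete_vertex :: "'a graph \<Rightarrow> 'a \<Rightarrow> 'a graph" where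
  "delete_vertex G v = Graph (verts G - {v}) {e \<in> edges G. v \<notin> e}"

definition delete_edges :: "'a graph \<Rightarrow> 'a set set \<Rightarrow> 'a graph" where
  "delete_edges G X = Graph (verts G) (edges G - X)"

definition graph_image :: "('a \<Rightarrow> 'b) \<Rightarrow> 'a graph \<Rightarrow> 'b graph" where
  "graph_image h G = Graph (h ` verts G) ((`) h ` edges G)"

definition graph_Union :: "'i set \<Rightarrow> ('i \<Rightarrow> 'a graph) \<Rightarrow> 'a graph" where
  "graph_Union I G = Graph (\<Union>i\<in>I. verts (G i)) (\<Union>i\<in>I. edges (G i))"

definition degree :: "'a graph \<Rightarrow> 'a \<Rightarrow> nat" where
  "degree G v = card {e \<in> edges G. v \<in> e}"

definition regular :: "nat \<Rightarrow> 'a graph \<Rightarrow> bool" where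
  "regular k G \<longleftrightarrow> simple_graph G \<and> (\<forall>v\<in>verts G. degree G v = k)"

abbreviation cubic :: "'a graph \<Rightarrow> bool" where
  "cubic \<equiv> regular 3"

definition connected :: "'a graph \<Rightarrow> bool" where
  "connected G \<longleftrightarrow> verts G \<noteq> {} \<and>
     (\<forall>u\<in>verts G. \<forall>v\<in>verts G. (u, v) \<in> {(a, b). {a, b} \<in> edges G}\<^sup>*)"

definition components :: "'a graph \<Rightarrow> 'a graph set" where
  "components G = {C. subgraph C G \<and> connected C \<and>
     (\<forall>D. subgraph D G \<and> connected D \<and> subgraph C D \<longrightarrow> D = C)}"

definition two_connected :: "'a graph \<Rightarrow> bool" where
  "two_connected G \<longleftrightarrow> card (verts G) > 2 \<and> connected G \<and>
     (\<forall>v\<in>verts G. connected (delete_vertex G v))"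

definition circuit :: "'a graph \<Rightarrow> bool" where
  "circuit C \<longleftrightarrow> regular 2 C \<and> two_connected C"

definition path_in :: "'a graph \<Rightarrow> 'a list \<Rightarrow> bool" where
  "path_in G vs \<longleftrightarrow> distinct vs \<and> set vs \<subseteq> verts G \<and>
     successively (\<lambda>u v. {u, v} \<in> edges G) vs"


section \<open>Permutation snarks\<close>

definition chordless :: "'a graph \<Rightarrow> 'a graph \<Rightarrow> bool" where
  "chordless G C \<longleftrightarrow> (\<forall>e\<in>edges G. e \<subseteq> verts C \<longrightarrow> e \<in> edges C)"

definition two_factor :: "'a graph \<Rightarrow> 'a graph \<Rightarrow> bool" where
  "two_factor G F \<longleftrightarrow> subgraph F G \<and> verts F = verts G \<and> regular 2 F"

definition permutation_two_factor :: "'a graph \<Rightarrow> 'a graph \<Rightarrow> bool" where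
  "permutation_two_factor G F \<longleftrightarrow> two_factor G F \<and>
     (\<exists>C1 C2. C1 \<noteq> C2 \<and> components F = {C1, C2} \<and>
        circuit C1 \<and> chordless G C1 \<and> circuit C2 \<and> chordless G C2)"

definition cycle_permutation_graph :: "'a graph \<Rightarrow> bool" where
  "cycle_permutation_graph G \<longleftrightarrow> cubic G \<and> (\<exists>F. permutation_two_factor G F)"

definition contains_circuit :: "'a graph \<Rightarrow> bool" where
  "contains_circuit G \<longleftrightarrow> (\<exists>C. subgraph C G \<and> circuit C)"

text \<open>The infimum over the empty set is \<open>\<infinity>\<close>, both for \<open>lambda_c\<close> and for \<open>girth\<close>.\<close>

definition lambda_c :: "'a graph \<Rightarrow> enat" where
  "lambda_c G = (INF X \<in> {X. X \<subseteq> edges G \<and>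
      (\<exists>K\<in>components (delete_edges G X). \<exists>L\<in>components (delete_edges G X).
         K \<noteq> L \<and> contains_circuit K \<and> contains_circuit L)}. enat (card X))"

definition cyclically_edge_connected :: "nat \<Rightarrow> 'a graph \<Rightarrow> bool" where
  "cyclically_edge_connected k G \<longleftrightarrow> enat k \<le> lambda_c G"

definition girth :: "'a graph \<Rightarrow> enat" where
  "girth G = (INF C \<in> {C. subgraph C G \<and> circuit C}. enat (card (edges C)))"

definition edge_colorable :: "nat \<Rightarrow> 'a graph \<Rightarrow> bool" where
  "edge_colorable k G \<longleftrightarrow> (\<exists>c :: 'a set \<Rightarrow> nat. (\<forall>e\<in>edges G. c e < k) \<and>
     (\<forall>e\<in>edges G. \<forall>f\<in>edges G. e \<noteq> f \<and> e \<inter> f \<noteq> {} \<longrightarrow> c e \<noteq> c f))"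

definition snark :: "'a graph \<Rightarrow> bool" where
  "snark G \<longleftrightarrow> cubic G \<and> cyclically_edge_connected 4 G \<and> 5 \<le> girth G \<and>
     \<not> edge_colorable 3 G"

definition permutation_snark :: "'a graph \<Rightarrow> bool" where
  "permutation_snark G \<longleftrightarrow> cycle_permutation_graph G \<and> snark G"


section \<open>Cycle double covers\<close>

definition cdc :: "'a graph \<Rightarrow> 'a graph set \<Rightarrow> bool" where
  "cdc G S \<longleftrightarrow>
     (\<forall>D\<in>S. subgraph D G \<and> (\<forall>C\<in>components D. circuit C)) \<and>
     (\<forall>e\<in>edges G. card {D \<in> S. e \<in> edges D} = 2)"

definition contained_in_some_cdc :: "'a graph \<Rightarrow> 'a graph \<Rightarrow> bool" where
  "contained_in_some_cdc G F \<longleftrightarrow>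
     (\<exists>S. cdc G S \<and> (\<forall>D\<in>S. circuit D) \<and> components F \<subseteq> S)"


section \<open>The graphs \<open>Q\<^sup>~\<close>\<close>

text \<open>
  \<open>x s\<close> (for \<open>s = 1,2,4,5,6\<close>) and \<open>z 1\<close>, \<open>z 2\<close> are the labelled vertices of \<open>Q\<close>;
  \<open>x 3\<close> is not used, since \<open>e\<^sub>3\<close> is attached to \<open>x 2\<close>.
\<close>

datatype 'a tvertex = Old 'a | Y nat

definition attach :: "(nat \<Rightarrow> 'a) \<Rightarrow> nat \<Rightarrow> 'a" where
  "attach x j = (if j = 3 then x 2 else x j)"

definition new_edges :: "(nat \<Rightarrow> 'a) \<Rightarrow> 'a tvertex set set" where
  "new_edges x = {{Old (attach x j), Y j} | j. j \<in> {1..6}}"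

definition kept_edges :: "'a graph \<Rightarrow> (nat \<Rightarrow> 'a) \<Rightarrow> (nat \<Rightarrow> 'a) \<Rightarrow> 'a set set" where
  "kept_edges G x z = {e \<in> edges G. e \<noteq> {x 1, x 2} \<and> z 1 \<notin> e \<and> z 2 \<notin> e}"

definition Q_tilde :: "'a graph \<Rightarrow> (nat \<Rightarrow> 'a) \<Rightarrow> (nat \<Rightarrow> 'a) \<Rightarrow> 'a tvertex graph" where
  "Q_tilde Q x z = Graph
     (Old ` (verts Q - {z 1, z 2}) \<union> Y ` {1..6})
     ((`) Old ` kept_edges Q x z \<union> new_edges x)"

text \<open>
  The subgraph of \<open>Q\<^sup>~\<close> induced by the six new edges and the remaining edges of \<open>F\<close>;
  its components are the three paths \<open>A\<^sub>1\<close>, \<open>A\<^sub>2\<close>, \<open>A\<^sub>3\<close>.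
\<close>

definition A_tilde :: "'a graph \<Rightarrow> (nat \<Rightarrow> 'a) \<Rightarrow> (nat \<Rightarrow> 'a) \<Rightarrow> 'a tvertex graph" where
  "A_tilde F x z = (let E = (`) Old ` kept_edges F x z \<union> new_edges x in Graph (\<Union>E) E)"


section \<open>The graph \<open>H\<close>\<close>

datatype 'a hvertex = Copy nat 'a | Vp | Vq

text \<open>\<open>((i, j), (k, l))\<close> stands for gluing the half-edge \<open>e\<^sub>j\<close> of the \<open>i\<close>-th graph with the
  half-edge \<open>e\<^sub>l\<close> of the \<open>k\<close>-th graph.\<close>

definition gluing :: "((nat \<times> nat) \<times> (nat \<times> nat)) list" where
  "gluing =
    [((1,1),(4,4)), ((1,3),(4,5)),
     ((4,1),(3,4)), ((4,2),(3,5)),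
     ((3,1),(2,4)), ((3,3),(2,5)),
     ((2,1),(1,4)), ((2,2),(1,5)),
     ((1,6),(3,6)), ((2,6),(4,6))]"

definition partner :: "nat \<times> nat \<Rightarrow> nat \<times> nat" where
  "partner h = the (map_of (gluing @ map prod.swap gluing) h)"

text \<open>
  The \<open>i\<close>-th graph \<open>Q\<^sup>~\<close> is mapped to \<open>H\<close> by sending \<open>y\<^sub>j\<close> to \<open>p\<close> or \<open>q\<close> in the four
  exceptional cases, and otherwise to the vertex at which the partner half-edge is attached.
  Hence an edge of \<open>H\<close> carries precisely the labels of its preimages, and the two edges
  of a glued pair have the same image.
\<close>

fun into_H :: "(nat \<Rightarrow> nat \<Rightarrow> 'a) \<Rightarrow> nat \<Rightarrow> 'a tvertex \<Rightarrow> 'a hvertex" where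
  "into_H x i (Old v) = Copy i v"
| "into_H x i (Y j) =
     (if (i, j) \<in> {(1,2), (3,2)} then Vp
      else if (i, j) \<in> {(2,3), (4,3)} then Vq
      else (case partner (i, j) of (k, l) \<Rightarrow> Copy k (attach (x k) l)))"

definition graph_H ::
  "(nat \<Rightarrow> 'a graph) \<Rightarrow> (nat \<Rightarrow> nat \<Rightarrow> 'a) \<Rightarrow> (nat \<Rightarrow> nat \<Rightarrow> 'a) \<Rightarrow> 'a hvertex graph" where
  "graph_H Qs x z =
     (let U = graph_Union {1..4} (\<lambda>i. graph_image (into_H x i) (Q_tilde (Qs i) (x i) (z i)))
      in Graph (verts U) (edges U \<union> {{Vp, Vq}}))"

definition A_H ::
  "(nat \<Rightarrow> 'a graph) \<Rightarrow> (nat \<Rightarrow> nat \<Rightarrow> 'a) \<Rightarrow> (nat \<Rightarrow> nat \<Rightarrow> 'a) \<Rightarrow> nat \<Rightarrow> 'a hvertex graph" where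
  "A_H Fs x z i = graph_image (into_H x i) (A_tilde (Fs i) (x i) (z i))"

definition factor_F ::
  "(nat \<Rightarrow> 'a graph) \<Rightarrow> (nat \<Rightarrow> nat \<Rightarrow> 'a) \<Rightarrow> (nat \<Rightarrow> nat \<Rightarrow> 'a) \<Rightarrow> 'a hvertex graph" where
  "factor_F Fs x z = graph_Union {1..4} (A_H Fs x z)"

end

(* Suppose that F belongs to a cycle double cover of H. Each edge of F lies in exactly one further
   element of the cover; take this element as its colour. At an edge uv outside F the two F-edges at
   u have different colours, and the same two colours occur at v. Conversely, such a colouring of a
   2-factor of a cubic graph yields a cycle double cover by circuits that contains the 2-factor.
   Restricted to the copy of the i-th graph, the colouring of H gives six colours on the half-edges
   e_1, ..., e_6. By double counting each colour occurs there an even number of times. Since F^i is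
   not contained in a cycle double cover of Q^i, the six colours do not extend to Q^i, even after
   exchanging e_2 and e_3, which are interchangeable because both are attached to x_2. The few
   remaining colour patterns on the four copies are incompatible with the gluing and with the
   condition at pq, where the two colours on either side coincide. *)

theory Submission
  imports Defs
begin

section \<open>Reachability, components and the edges at a vertex\<close>

section \<open>Components\<close>

definition star :: "'a graph \<Rightarrow> 'a \<Rightarrow> 'a set set" where
  "star G v = {e \<in> edges G. v \<in> e}"

definition adj :: "'a graph \<Rightarrow> ('a \<times> 'a) set" where
  "adj G = {(a, b). {a, b} \<in> edges G}"

text \<open>Weaker than \<open>simple_graph\<close>: loops and infinite vertex sets are allowed. It
  passes to subgraphs, supports the theory of components, and is the form established for
  \<open>H\<close>.\<close>

definition pair_graph :: "'a graph \<Rightarrow> bool" where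
  "pair_graph G \<longleftrightarrow> (\<forall>e\<in>edges G. e \<subseteq> verts G \<and> (\<exists>a b. e = {a, b}))"

text \<open>Reachability replaces the maximality in \<open>components\<close>; for a vertex of a
  \<open>pair_graph\<close> the lemmas below identify the two.\<close>

definition component_of :: "'a graph \<Rightarrow> 'a \<Rightarrow> 'a graph" where
  "component_of G u = Graph {w. (u, w) \<in> (adj G)\<^sup>*} {e \<in> edges G. e \<subseteq> {w. (u, w) \<in> (adj G)\<^sup>*}}"

lemma degree_eq_card_star: "degree G v = card (star G v)"
  by (simp add: degree_def star_def)

lemma connected_iff:
  "connected G \<longleftrightarrow> verts G \<noteq> {} \<and> (\<forall>u\<in>verts G. \<forall>v\<in>verts G. (u, v) \<in> (adj G)\<^sup>*)"
  by (simp add: connected_def adj_def)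

lemma sym_adj: "sym (adj G)"
  by (auto simp: adj_def sym_def insert_commute)

lemma rtrancl_adj_sym: "(u, v) \<in> (adj G)\<^sup>* \<Longrightarrow> (v, u) \<in> (adj G)\<^sup>*"
  using sym_adj sym_rtrancl symD by metis

lemma subgraph_adj_mono: "subgraph D G \<Longrightarrow> adj D \<subseteq> adj G"
  by (auto simp: subgraph_def adj_def)

lemma subgraph_pair_graph: "subgraph D G \<Longrightarrow> pair_graph G \<Longrightarrow> pair_graph D"
  by (simp add: subgraph_def pair_graph_def subset_iff)

lemma simple_graph_pair_graph: "simple_graph G \<Longrightarrow> pair_graph G"
  unfolding simple_graph_def pair_graph_def card_2_iff by metis

lemma subgraph_refl: "pair_graph G \<Longrightarrow> subgraph G G"
  by (auto simp: subgraph_def pair_graph_def)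

lemma rtrancl_adj_verts:
  assumes "pair_graph G" "u \<in> verts G" "(u, w) \<in> (adj G)\<^sup>*"
  shows "w \<in> verts G"
  using assms(3,2)
  by induction (use assms(1) in \<open>auto simp: adj_def pair_graph_def\<close>)

lemma subgraph_component_of:
  assumes "subgraph D G" "connected D" "u \<in> verts D"
  shows "subgraph D (component_of G u)"
proof -
  have "(u, w) \<in> (adj G)\<^sup>*" if "w \<in> verts D" for w
    using assms that rtrancl_mono[OF subgraph_adj_mono[OF assms(1)]]
    by (auto simp: connected_iff)
  with assms(1) show ?thesis
    unfolding subgraph_def component_of_def by (simp add: subset_iff)
qed

lemma component_of_subgraph:
  assumes "pair_graph G" "u \<in> verts G"
  shows "subgraph (component_of G u) G"
  using assms rtrancl_adj_verts[OF assms] by (auto simp: subgraph_def component_of_def)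

lemma connected_component_of: "connected (component_of G u)"
proof -
  let ?C = "component_of G u"
  have reach: "(u, w) \<in> (adj ?C)\<^sup>*" if "(u, w) \<in> (adj G)\<^sup>*" for w
    using that
  proof induction
    case (step y z)
    then have "(y, z) \<in> adj ?C"
      by (auto simp: adj_def component_of_def intro: rtrancl.rtrancl_into_rtrancl)
    with step show ?case by (meson rtrancl.rtrancl_into_rtrancl)
  qed simp
  show ?thesis
    unfolding connected_iff
  proof (intro conjI ballI)
    show "verts ?C \<noteq> {}" by (auto simp: component_of_def)
  next
    fix a b assume "a \<in> verts ?C" "b \<in> verts ?C"
    then have "(u, a) \<in> (adj ?C)\<^sup>*" "(u, b) \<in> (adj ?C)\<^sup>*"
      using reach by (auto simp: component_of_def)
    then show "(a, b) \<in> (adj ?C)\<^sup>*"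
      using rtrancl_adj_sym rtrancl_trans by metis
  qed
qed

lemma subgraph_antisym: "subgraph C D \<Longrightarrow> subgraph D C \<Longrightarrow> C = D"
  by (auto simp: subgraph_def intro: graph.expand)

lemma component_of_in_components:
  assumes "pair_graph G" "u \<in> verts G"
  shows "component_of G u \<in> components G"
proof -
  have "D = component_of G u"
    if "subgraph D G" "connected D" "subgraph (component_of G u) D" for D
  proof -
    have "u \<in> verts D"
      using that(3) by (auto simp: subgraph_def component_of_def)
    with that show ?thesis
      using subgraph_component_of subgraph_antisym by metis
  qed
  then show ?thesis
    using component_of_subgraph[OF assms] connected_component_of[of G u]
    by (auto simp: components_def)
qed

lemma components_eq_component_of:
  assumes "pair_graph G" "C \<in> components G" "u \<in> verts C"
  shows "C = component_of G u"
proof -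
  have C: "subgraph C G" "connected C"
    "\<And>D. subgraph D G \<Longrightarrow> connected D \<Longrightarrow> subgraph C D \<Longrightarrow> D = C"
    using assms(2) by (auto simp: components_def)
  have "u \<in> verts G" using C(1) assms(3) by (auto simp: subgraph_def)
  then show ?thesis
    using C assms component_of_subgraph connected_component_of subgraph_component_of by metis
qed

lemma components_of_connected:
  assumes "pair_graph G" "connected G" "C \<in> components G"
  shows "C = G"
  using assms subgraph_refl by (auto simp: components_def)

text \<open>An edge at a reachable vertex has a reachable other end, so no edge is lost. Degrees in
  a component are therefore those in the whole graph.\<close>

lemma star_component_of:
  assumes "pair_graph G" "w \<in> verts (component_of G u)"
  shows "star (component_of G u) w = star G w"
proof -
  have "e \<subseteq> {w. (u, w) \<in> (adj G)\<^sup>*}" if e: "e \<in> edges G" "w \<in> e" for e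
  proof
    fix b assume "b \<in> e"
    obtain a' b' where "e = {a', b'}" using assms(1) e by (auto simp: pair_graph_def)
    with e \<open>b \<in> e\<close> have "b = w \<or> (w, b) \<in> adj G"
      by (auto simp: adj_def insert_commute)
    then show "b \<in> {w. (u, w) \<in> (adj G)\<^sup>*}"
      using assms(2) by (auto simp: component_of_def intro: rtrancl.rtrancl_into_rtrancl)
  qed
  then show ?thesis by (auto simp: star_def component_of_def)
qed

lemma component_of_self: "u \<in> verts (component_of G u)"
  by (simp add: component_of_def)

text \<open>Passing from a graph to its components does not change how often an edge is covered,
  which the counts for double covers need.\<close>

lemma components_containing_edge:
  assumes "pair_graph G" "e \<in> edges G" "u \<in> e"
  shows "{C \<in> components G. e \<in> edges C} = {component_of G u}"
proof -
  have u: "u \<in> verts G" using assms by (auto simp: pair_graph_def)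
  have "e \<in> edges (component_of G u)"
    using star_component_of[OF assms(1) component_of_self, of u] assms by (auto simp: star_def)
  moreover have "C = component_of G u" if "C \<in> components G" "e \<in> edges C" for C
  proof -
    have "u \<in> verts C"
      using that \<open>u \<in> e\<close> by (auto simp: components_def subgraph_def)
    then show ?thesis using components_eq_component_of[OF assms(1) that(1)] by blast
  qed
  moreover have "component_of G u \<in> components G"
    using component_of_in_components[OF assms(1) u] .
  ultimately show ?thesis by blast
qed


section \<open>Connected 2-regular graphs as circuits\<close>

section \<open>Components of 2-regular graphs\<close>

text \<open>Double counting of incident pairs; below, only the parity of the degree sum
  matters.\<close>

lemma handshake:
  assumes "simple_graph G"
  shows "(\<Sum>v\<in>verts G. card (star G v)) = 2 * card (edges G)"
proof -
  have fin: "finite (verts G)" "finite (edges G)"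
    using assms finite_subset[of "edges G" "Pow (verts G)"] by (auto simp: simple_graph_def)
  have "{v \<in> verts G. v \<in> e} = e" if "e \<in> edges G" for e
    using assms that by (auto simp: simple_graph_def)
  then have "\<forall>e\<in>edges G. card {v \<in> verts G. v \<in> e} = 2"
    using assms by (simp add: simple_graph_def)
  from sum_multicount[OF fin this] show ?thesis by (simp add: star_def)
qed

lemma simple_graph_subgraph:
  "subgraph D G \<Longrightarrow> simple_graph G \<Longrightarrow> simple_graph D"
  by (auto simp: subgraph_def simple_graph_def intro: finite_subset)

lemma star_delete_vertex: "star (delete_vertex G v) w = star G w - star G v"
  by (auto simp: star_def delete_vertex_def)

lemma edge_at:
  assumes "simple_graph G" "e \<in> star G v"
  obtains w where "e = {v, w}" "w \<noteq> v" "w \<in> verts G"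
proof -
  have "card e = 2" "v \<in> e" "e \<subseteq> verts G"
    using assms by (auto simp: star_def simple_graph_def)
  then obtain a b where "e = {a, b}" "a \<noteq> b" by (auto simp: card_2_iff)
  with \<open>v \<in> e\<close> \<open>e \<subseteq> verts G\<close> have "e = {v, if v = a then b else a}"
    "(if v = a then b else a) \<noteq> v" "(if v = a then b else a) \<in> verts G" by auto
  then show thesis by (rule that)
qed

text \<open>A walk to \<open>v\<close> passes one of its two neighbours first, so deleting
  \<open>v\<close> could only separate these neighbours from each other, and parity of the degree
  sum excludes that.\<close>

lemma circuit_if_connected_2_regular:
  assumes reg: "regular 2 G" and con: "connected G"
  shows "circuit G"
proof -
  have sim: "simple_graph G" and deg: "\<And>v. v \<in> verts G \<Longrightarrow> card (star G v) = 2"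
    using reg by (auto simp: regular_def degree_eq_card_star)
  have pg: "pair_graph G" using sim by (rule simple_graph_pair_graph)
  have nbrs: "\<exists>a b. star G v = {{v, a}, {v, b}} \<and> a \<noteq> b \<and> a \<noteq> v \<and> b \<noteq> v \<and> a \<in> verts G \<and> b \<in> verts G"
    if v: "v \<in> verts G" for v
  proof -
    obtain e f where ef: "star G v = {e, f}" "e \<noteq> f"
      using deg[OF v] by (auto simp: card_2_iff)
    then have mem: "e \<in> star G v" "f \<in> star G v" by auto
    obtain a where a: "e = {v, a}" "a \<noteq> v" "a \<in> verts G" by (rule edge_at[OF sim mem(1)])
    obtain b where b: "f = {v, b}" "b \<noteq> v" "b \<in> verts G" by (rule edge_at[OF sim mem(2)])
    have "star G v = {{v, a}, {v, b}}" "a \<noteq> b"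
      using ef unfolding a b by blast+
    with a b show ?thesis by blast
  qed
  have "card (verts G) > 2"
  proof -
    obtain v where v: "v \<in> verts G" using con by (auto simp: connected_def)
    from nbrs[OF v] obtain a b where "a \<noteq> b" "a \<noteq> v" "b \<noteq> v" "a \<in> verts G" "b \<in> verts G" by blast
    then have "card {v, a, b} = 3" "{v, a, b} \<subseteq> verts G" using v by auto
    moreover have "finite (verts G)" using sim by (simp add: simple_graph_def)
    ultimately show ?thesis using card_mono[of "verts G" "{v, a, b}"] by linarith
  qed
  moreover have "connected (delete_vertex G v)" if v: "v \<in> verts G" for v
  proof -
    let ?D = "delete_vertex G v"
    from nbrs[OF v] obtain a b where ab: "star G v = {{v, a}, {v, b}}" "a \<noteq> b" "a \<noteq> v" "b \<noteq> v"
      "a \<in> verts G" "b \<in> verts G" by blast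
    have sub: "subgraph ?D G"
      using pg by (auto simp: subgraph_def delete_vertex_def pair_graph_def)
    have simD: "simple_graph ?D" using simple_graph_subgraph[OF sub sim] .
    have pgD: "pair_graph ?D" using simD by (rule simple_graph_pair_graph)
    have aD: "a \<in> verts ?D" using ab by (simp add: delete_vertex_def)
    have to_ab: "w \<noteq> v \<longrightarrow> (w, a) \<in> (adj ?D)\<^sup>* \<or> (w, b) \<in> (adj ?D)\<^sup>*"
      if "(w, v) \<in> (adj G)\<^sup>*" for w
      using that
    proof (induction rule: converse_rtrancl_induct)
      case (step w w')
      show ?case
      proof
        assume "w \<noteq> v"
        show "(w, a) \<in> (adj ?D)\<^sup>* \<or> (w, b) \<in> (adj ?D)\<^sup>*"
        proof (cases "w' = v")
          case True
          then have "{w, v} \<in> star G v" using step by (simp add: star_def adj_def)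
          then have "w = a \<or> w = b" using ab \<open>w \<noteq> v\<close> by (auto simp: doubleton_eq_iff)
          then show ?thesis by auto
        next
          case False
          then have "(w, w') \<in> adj ?D"
            using step \<open>w \<noteq> v\<close> by (auto simp: adj_def delete_vertex_def)
          with False step.IH show ?thesis by (meson converse_rtrancl_into_rtrancl)
        qed
      qed
    qed simp
    \<comment> \<open>Otherwise the component of \<open>a\<close> has a single vertex of odd degree.\<close>
    have "(a, b) \<in> (adj ?D)\<^sup>*"
    proof (rule ccontr)
      assume nab: "(a, b) \<notin> (adj ?D)\<^sup>*"
      let ?K = "component_of ?D a"
      have subK: "subgraph ?K ?D" using component_of_subgraph[OF pgD aD] .
      have simK: "simple_graph ?K" using simple_graph_subgraph[OF subK simD] .
      have bK: "b \<notin> verts ?K" using nab by (simp add: component_of_def)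
      have starK: "star ?K w = star G w - {{v, a}, {v, b}}" if "w \<in> verts ?K" for w
        using star_component_of[OF pgD that] ab(1) by (simp add: star_delete_vertex)
      have inG: "w \<in> verts G \<and> w \<noteq> v" if "w \<in> verts ?K" for w
        using subK that by (auto simp: subgraph_def delete_vertex_def)
      have deg_w: "card (star ?K w) = 2" if "w \<in> verts ?K" "w \<noteq> a" for w
      proof -
        have "{v, a} \<notin> star G w" "{v, b} \<notin> star G w"
          using inG[OF that(1)] that bK by (auto simp: star_def)
        then show ?thesis using starK[OF that(1)] deg[of w] inG[OF that(1)] by simp
      qed
      have deg_a: "card (star ?K a) = 1"
      proof -
        have "{v, b} \<notin> star G a" using ab by (auto simp: star_def)
        moreover have "{v, a} \<in> star G a" using ab(1) by (auto simp: star_def)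
        ultimately have "star ?K a = star G a - {{v, a}}"
          using starK[OF component_of_self] by auto
        then show ?thesis
          using \<open>{v, a} \<in> star G a\<close> deg[OF ab(5)] by (simp add: card_Diff_singleton_if)
      qed
      have fin: "finite (verts ?K)" using simK by (simp add: simple_graph_def)
      have "(\<Sum>w\<in>verts ?K. card (star ?K w)) = 1 + (\<Sum>w\<in>verts ?K - {a}. card (star ?K w))"
        using sum.remove[OF fin component_of_self, of "\<lambda>w. card (star ?K w)"] deg_a by simp
      also have "(\<Sum>w\<in>verts ?K - {a}. card (star ?K w)) = (\<Sum>w\<in>verts ?K - {a}. 2)"
        by (rule sum.cong) (use deg_w in auto)
      finally have "odd (\<Sum>w\<in>verts ?K. card (star ?K w))" by simp
      then show False using handshake[OF simK] by simp
    qed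
    then have to_a: "(w, a) \<in> (adj ?D)\<^sup>*" if "w \<in> verts ?D" for w
    proof -
      have "w \<noteq> v" "(w, v) \<in> (adj G)\<^sup>*"
        using that con v by (auto simp: delete_vertex_def connected_iff)
      then show ?thesis
        using to_ab \<open>(a, b) \<in> (adj ?D)\<^sup>*\<close> by (meson rtrancl_adj_sym rtrancl_trans)
    qed
    show ?thesis
      unfolding connected_iff
    proof (intro conjI ballI)
      show "verts ?D \<noteq> {}" using aD by blast
    next
      fix w w' assume "w \<in> verts ?D" "w' \<in> verts ?D"
      then show "(w, w') \<in> (adj ?D)\<^sup>*"
        using to_a rtrancl_adj_sym rtrancl_trans by metis
    qed
  qed
  ultimately show ?thesis using reg con by (auto simp: circuit_def two_connected_def)
qed

lemma circuit_component:
  assumes "regular 2 G" "C \<in> components G"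
  shows "circuit C"
proof -
  have sim: "simple_graph G" using assms(1) by (simp add: regular_def)
  have pg: "pair_graph G" using sim by (rule simple_graph_pair_graph)
  have C: "subgraph C G" "connected C" using assms(2) by (auto simp: components_def)
  have "degree C w = 2" if w: "w \<in> verts C" for w
  proof -
    have C_eq: "C = component_of G w" using components_eq_component_of[OF pg assms(2) w] .
    then have "star C w = star G w" using star_component_of[OF pg, of w w] w by simp
    then show ?thesis
      using assms(1) C(1) w by (auto simp: regular_def degree_eq_card_star subgraph_def)
  qed
  then have "regular 2 C"
    using simple_graph_subgraph[OF C(1) sim] by (simp add: regular_def)
  then show ?thesis using C(2) by (rule circuit_if_connected_2_regular)
qed


section \<open>From a double cover containing the 2-factor to a colouring\<close>

section \<open>Cycle double covers as edge colourings of a 2-factor\<close>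

text \<open>
  The colour of an edge of \<open>F\<close> stands for the second element of the cover that contains it.
\<close>

definition face_coloring :: "'a graph \<Rightarrow> 'a graph \<Rightarrow> ('a set \<Rightarrow> 'c) \<Rightarrow> bool" where
  "face_coloring G F c \<longleftrightarrow> (\<forall>u v. {u, v} \<in> edges G - edges F \<longrightarrow>
     card (c ` star F u) = 2 \<and> c ` star F u = c ` star F v)"

text \<open>An element of a cover may be disconnected, but its component through \<open>u\<close> is
  a circuit and has all its edges at \<open>u\<close>.\<close>

lemma cdc_card_star:
  assumes "pair_graph G" "cdc G S" "D \<in> S" "star D u \<noteq> {}"
  shows "card (star D u) = 2"
proof -
  have sub: "subgraph D G" and circ: "\<And>C. C \<in> components D \<Longrightarrow> circuit C"
    using assms by (auto simp: cdc_def)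
  have pg: "pair_graph D" using subgraph_pair_graph[OF sub assms(1)] .
  have "u \<in> verts D" using assms(4) pg by (auto simp: star_def pair_graph_def)
  then have "circuit (component_of D u)" using circ component_of_in_components[OF pg] by blast
  then show ?thesis
    using star_component_of[OF pg component_of_self, of u] component_of_self[of u D]
    by (auto simp: circuit_def regular_def degree_eq_card_star)
qed

text \<open>A cover element through an edge outside \<open>F\<close> continues at either end along
  an edge of \<open>F\<close>, so both ends see exactly the two elements through that edge.
  \<open>cubic_at\<close> is the local form of cubicity that makes this work.\<close>

lemma face_coloring_from_cdc:
  assumes pg: "pair_graph G" and cdc: "cdc G S" and F: "F \<in> S"
    and cubic_at: "\<And>e u. e \<in> star G u - edges F \<Longrightarrow> star G u \<subseteq> insert e (star F u)"
  obtains c :: "'a set \<Rightarrow> 'a graph" where "face_coloring G F c"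
proof
  \<comment> \<open>The second cover element through \<open>e\<close>; the value is meaningful only
    on edges of \<open>F\<close>.\<close>
  define c where "c e = (THE D. D \<in> S \<and> D \<noteq> F \<and> e \<in> edges D)" for e
  have sub: "subgraph D G" if "D \<in> S" for D using cdc that by (auto simp: cdc_def)
  have two: "card {D \<in> S. e \<in> edges D} = 2" if "e \<in> edges G" for e
    using cdc that by (auto simp: cdc_def)
  have c_eq: "c e = D" if e: "e \<in> edges F" "D \<in> S" "D \<noteq> F" "e \<in> edges D" for e D
  proof -
    have "e \<in> edges G" using sub[OF F] e by (auto simp: subgraph_def)
    from two[OF this] obtain A B where "{D \<in> S. e \<in> edges D} = {A, B}"
      by (auto simp: card_2_iff)
    moreover have "F \<in> {D \<in> S. e \<in> edges D}" "D \<in> {D \<in> S. e \<in> edges D}" using e F by auto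
    ultimately have "{D \<in> S. e \<in> edges D} = {F, D}" using e(3) by auto
    then show ?thesis unfolding c_def using e by (intro the_equality) auto
  qed
  have at: "c ` star F w = {D \<in> S. m \<in> edges D}"
    if m: "m \<in> edges G - edges F" "w \<in> m" for m w
  proof -
    have mw: "m \<in> star G w - edges F" using m by (auto simp: star_def)
    \<comment> \<open>One inclusion suffices: the right side has at most two elements, the left side
      exactly two.\<close>
    have sup: "{D \<in> S. m \<in> edges D} \<subseteq> c ` star F w"
    proof
      fix D assume D: "D \<in> {D \<in> S. m \<in> edges D}"
      then have mD: "m \<in> star D w" using m by (auto simp: star_def)
      then have "card (star D w) = 2" using cdc_card_star[OF pg cdc] D by blast
      with mD obtain e where e: "e \<in> star D w" "e \<noteq> m"
        by (metis card_2_iff insertCI)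
      have "e \<in> star G w" using e D sub by (auto simp: star_def subgraph_def)
      then have "e \<in> star F w" using cubic_at[OF mw] e by auto
      moreover have "c e = D"
        using D m(1) e calculation by (intro c_eq) (auto simp: star_def)
      ultimately show "D \<in> c ` star F w" by blast
    qed
    have two_m: "card {D \<in> S. m \<in> edges D} = 2" using two m by blast
    then have "star F w \<noteq> {}" using sup by (metis card.empty image_empty subset_empty zero_neq_numeral)
    then have "card (star F w) = 2" using cdc_card_star[OF pg cdc F] by blast
    then have "finite (star F w)" "card (c ` star F w) \<le> 2"
      using card_ge_0_finite[of "star F w"] card_image_le[of "star F w" c] by auto
    then show ?thesis using card_seteq[OF _ sup] two_m by simp
  qed
  show "face_coloring G F c"
    unfolding face_coloring_def
  proof (intro allI impI)
    fix u v assume uv: "{u, v} \<in> edges G - edges F"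
    show "card (c ` star F u) = 2 \<and> c ` star F u = c ` star F v"
      using at[OF uv, of u] at[OF uv, of v] two uv by simp
  qed
qed

section \<open>From a colouring back to a double cover by circuits\<close>

lemma finite_star: "simple_graph G \<Longrightarrow> finite (star G v)"
  unfolding simple_graph_def star_def
  by (rule finite_subset[of _ "Pow (verts G)"]) auto

lemma star_cubic_two_factor:
  assumes "cubic Q" "two_factor Q F" "v \<in> verts Q"
  obtains m where "m \<in> edges Q - edges F" "v \<in> m" "star Q v = insert m (star F v)"
proof -
  have sim: "simple_graph Q" using assms by (simp add: regular_def)
  have sub: "star F v \<subseteq> star Q v" using assms(2) by (auto simp: star_def two_factor_def subgraph_def)
  have "card (star Q v) = 3" "card (star F v) = 2"
    using assms by (auto simp: regular_def two_factor_def degree_eq_card_star)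
  then have "card (star Q v - star F v) = 1"
    using sub finite_star[OF sim] by (simp add: card_Diff_subset finite_subset)
  then obtain m where m: "star Q v - star F v = {m}" by (auto simp: card_1_singleton_iff)
  show thesis
  proof (rule that)
    show "m \<in> edges Q - edges F" "v \<in> m" using m by (auto simp: star_def)
    show "star Q v = insert m (star F v)" using m sub by blast
  qed
qed

text \<open>A colour class, joined with the edges outside \<open>F\<close> that see this colour, is
  2-regular: each of its vertices has one edge in \<open>F\<close> and one outside. The components
  of these graphs and of \<open>F\<close> form the cover. An edge of \<open>F\<close> lies in its
  circuit of \<open>F\<close> and in its colour, any other edge in the two colours it sees.\<close>

lemma contained_in_some_cdc_if_face_coloring:
  fixes c :: "'a set \<Rightarrow> 'c"
  assumes cub: "cubic Q" and tf: "two_factor Q F" and col: "face_coloring Q F c"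
  shows "contained_in_some_cdc Q F"
proof -
  \<comment> \<open>Any end of \<open>m\<close> may serve in the existential, since both ends see
    the same colours.\<close>
  define E where "E k = {f \<in> edges F. c f = k} \<union>
    {m \<in> edges Q - edges F. \<exists>u\<in>m. k \<in> c ` star F u}" for k
  define D where "D k = Graph (\<Union>(E k)) (E k)" for k
  have simQ: "simple_graph Q" using cub by (simp add: regular_def)
  have pgQ: "pair_graph Q" using simQ by (rule simple_graph_pair_graph)
  have subF: "subgraph F Q" and vF: "verts F = verts Q" and regF: "regular 2 F"
    using tf by (auto simp: two_factor_def)
  have pgF: "pair_graph F" using subgraph_pair_graph[OF subF pgQ] .
  have EQ: "E k \<subseteq> edges Q" for k using subF by (auto simp: E_def subgraph_def)
  have subD: "subgraph (D k) Q" for k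
    using EQ[of k] pgQ by (auto simp: subgraph_def D_def pair_graph_def)
  have simD: "simple_graph (D k)" for k using simple_graph_subgraph[OF subD simQ] .
  have pgD: "pair_graph (D k)" for k using simD by (rule simple_graph_pair_graph)
  have card_F: "card (star F v) = 2" if "v \<in> verts Q" for v
    using regF vF that by (auto simp: regular_def degree_eq_card_star)
  have same: "c ` star F u = c ` star F v" and two_colors: "card (c ` star F u) = 2"
    if m: "m \<in> edges Q - edges F" "u \<in> m" "v \<in> m" for m u v
  proof -
    obtain a b where ab: "m = {a, b}" using pgQ m by (auto simp: pair_graph_def)
    then have "{a, b} \<in> edges Q - edges F" "{b, a} \<in> edges Q - edges F"
      using m by (auto simp: insert_commute)
    then show "c ` star F u = c ` star F v" "card (c ` star F u) = 2"
      using col m ab unfolding face_coloring_def by blast+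
  qed
  have star_D: "\<exists>m f. star (D k) v = {m, f} \<and> m \<in> edges Q - edges F \<and> f \<in> star F v \<and> c f = k"
    if v: "v \<in> verts (D k)" for k v
  proof -
    have vQ: "v \<in> verts Q" using subD[of k] v by (auto simp: subgraph_def)
    obtain m where m: "m \<in> edges Q - edges F" "v \<in> m" "star Q v = insert m (star F v)"
      by (rule star_cubic_two_factor[OF cub tf vQ])
    obtain e where e: "e \<in> E k" "v \<in> e" using v by (auto simp: D_def)
    have k: "k \<in> c ` star F v"
    proof (cases "e \<in> edges F")
      case True
      with e show ?thesis by (auto simp: E_def star_def)
    next
      case False
      with e obtain u where "e \<in> edges Q - edges F" "u \<in> e" "k \<in> c ` star F u"
        by (auto simp: E_def)
      with same[of e u v] e show ?thesis by simp
    qed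
    then obtain f where f: "f \<in> star F v" "c f = k" by auto
    have inj: "inj_on c (star F v)"
      using two_colors[OF m(1,2,2)] card_F[OF vQ]
      by (intro eq_card_imp_inj_on) (auto intro: card_ge_0_finite)
    have "star (D k) v = {m, f}"
    proof (intro set_eqI iffI)
      fix g assume g: "g \<in> star (D k) v"
      then have "g \<in> E k" "g \<in> star Q v" using EQ by (auto simp: star_def D_def)
      moreover from this have "g = f" if "g \<in> star F v"
        using f that inj by (auto simp: E_def star_def dest: inj_onD)
      ultimately show "g \<in> {m, f}" using m(3) by auto
    next
      fix g assume "g \<in> {m, f}"
      then show "g \<in> star (D k) v"
        using m f k by (auto simp: star_def D_def E_def)
    qed
    then show ?thesis using m f by blast
  qed
  have regD: "regular 2 (D k)" for k
  proof -
    have "degree (D k) v = 2" if v: "v \<in> verts (D k)" for v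
    proof -
      from star_D[OF v] obtain m f where "star (D k) v = {m, f}" "m \<in> edges Q - edges F" "f \<in> star F v"
        by blast
      moreover from this have "m \<noteq> f" by (auto simp: star_def)
      ultimately show ?thesis by (simp add: degree_eq_card_star)
    qed
    then show ?thesis using simD by (simp add: regular_def)
  qed
  define S where "S = components F \<union> (\<Union>k. components (D k))"
  have circ: "circuit C" if "C \<in> S" for C
    using that circuit_component[OF regF] circuit_component[OF regD] by (auto simp: S_def)
  have subS: "subgraph C Q" if "C \<in> S" for C
  proof -
    have trans: "subgraph C H \<Longrightarrow> subgraph H Q \<Longrightarrow> subgraph C Q" for H
      by (simp add: subgraph_def subset_iff)
    from that consider "C \<in> components F" | k where "C \<in> components (D k)"
      unfolding S_def by blast
    then show ?thesis
    proof cases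
      case 1
      then show ?thesis using trans[OF _ subF] by (simp add: components_def)
    next
      case (2 k)
      then show ?thesis using trans[OF _ subD[of k]] by (simp add: components_def)
    qed
  qed
  have compF: "{C \<in> components F. e \<in> edges C} = (if e \<in> edges F then {component_of F u} else {})"
    if "u \<in> e" for e u
    using components_containing_edge[OF pgF _ that] by (auto simp: components_def subgraph_def)
  have compD: "{C \<in> components (D k). e \<in> edges C} = (if e \<in> E k then {component_of (D k) u} else {})"
    if "u \<in> e" for e u k
    using components_containing_edge[OF pgD _ that, of k] by (auto simp: components_def subgraph_def D_def)
  have S_split: "{C \<in> S. e \<in> edges C} = {C \<in> components F. e \<in> edges C} \<union>
     (\<Union>k. {C \<in> components (D k). e \<in> edges C})" for e
    by (auto simp: S_def)
  have starC: "star (component_of (D k) u) u = star (D k) u" for k u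
    by (rule star_component_of[OF pgD component_of_self])
  have "card {C \<in> S. e \<in> edges C} = 2" if e: "e \<in> edges Q" for e
  proof -
    obtain a b where "e = {a, b}" using pgQ e by (auto simp: pair_graph_def)
    then obtain u where u: "u \<in> e" by blast
    show ?thesis
    proof (cases "e \<in> edges F")
      case True
      then have Ek: "e \<in> E k \<longleftrightarrow> k = c e" for k by (auto simp: E_def)
      have "{C \<in> S. e \<in> edges C} = {component_of F u, component_of (D (c e)) u}"
        unfolding S_split compF[OF u] compD[OF u] Ek using True by auto
      \<comment> \<open>\<open>S\<close> is a set, so the two circuits through \<open>e\<close> have
        to be distinct. An edge outside \<open>F\<close> at \<open>u\<close> belongs to the second
        only.\<close>
      moreover have "component_of F u \<noteq> component_of (D (c e)) u"
      proof -
        have "e \<in> E (c e)" by (simp only: Ek)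
        with u have "u \<in> verts (D (c e))" unfolding D_def graph.sel by blast
        from star_D[OF this] obtain m f
          where "star (D (c e)) u = {m, f}" "m \<in> edges Q - edges F" by blast
        then have "m \<in> star (D (c e)) u" "m \<notin> edges F" by auto
        then have "m \<in> edges (component_of (D (c e)) u)" "m \<notin> edges (component_of F u)"
          using starC[of "c e" u] by (auto simp: star_def component_of_def)
        then show ?thesis by metis
      qed
      ultimately show ?thesis by simp
    next
      case False
      then have eM: "e \<in> edges Q - edges F" using e by blast
      have Ek: "e \<in> E k \<longleftrightarrow> k \<in> c ` star F u" for k
      proof -
        have "(\<exists>w\<in>e. k \<in> c ` star F w) \<longleftrightarrow> k \<in> c ` star F u"
          using same[OF eM _ u] u by metis
        then show ?thesis using eM False by (simp add: E_def)
      qed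
      obtain a b where ab: "c ` star F u = {a, b}" "a \<noteq> b"
        using two_colors[OF eM u u] by (auto simp: card_2_iff)
      have "{C \<in> S. e \<in> edges C} = {component_of (D a) u, component_of (D b) u}"
        unfolding S_split compF[OF u] compD[OF u] Ek ab(1) using False by auto
      \<comment> \<open>The edge of \<open>F\<close> at \<open>u\<close> with colour
        \<open>a\<close> tells the two circuits apart.\<close>
      moreover have "component_of (D a) u \<noteq> component_of (D b) u"
      proof -
        have "e \<in> E a" by (simp only: Ek ab(1) insertI1)
        with u have "u \<in> verts (D a)" unfolding D_def graph.sel by blast
        from star_D[OF this] obtain m f
          where mf: "star (D a) u = {m, f}" and f: "f \<in> star F u" "c f = a" by blast
        have "f \<in> star (D a) u" by (simp add: mf)
        then have "f \<in> edges (component_of (D a) u)" using starC[of a u] by (auto simp: star_def)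
        moreover have "f \<notin> edges (component_of (D b) u)"
          using f ab(2) by (auto simp: component_of_def D_def E_def star_def)
        ultimately show ?thesis by metis
      qed
      ultimately show ?thesis by simp
    qed
  qed
  \<comment> \<open>\<open>cdc\<close> tests the components of each element; a circuit is connected
    and hence its own only component.\<close>
  moreover have "C' = C" if "C \<in> S" "C' \<in> components C" for C C'
  proof -
    have "connected C" using circ[OF that(1)] by (simp add: circuit_def two_connected_def)
    then show ?thesis
      using components_of_connected that subgraph_pair_graph[OF subS[OF that(1)] pgQ] by blast
  qed
  ultimately have "cdc Q S" using subS circ unfolding cdc_def by blast
  then show ?thesis using circ by (auto simp: contained_in_some_cdc_def S_def)
qed


section \<open>The opened graph \<open>Q_tilde\<close>: its edges, colourings, parity and extension
  to \<open>Q\<close>\<close>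

section \<open>Colourings of \<open>Q\<^sup>~\<close>\<close>

abbreviation half_edge :: "(nat \<Rightarrow> 'a) \<Rightarrow> nat \<Rightarrow> 'a tvertex set" where
  "half_edge x j \<equiv> {Old (attach x j), Y j}"

lemma new_edges_eq: "new_edges x = half_edge x ` {1..6}"
  by (auto simp: new_edges_def)

lemma edges_Q_tilde: "edges (Q_tilde Q x z) = (`) Old ` kept_edges Q x z \<union> half_edge x ` {1..6}"
  by (simp add: Q_tilde_def new_edges_eq)

lemma edges_A_tilde: "edges (A_tilde F x z) = (`) Old ` kept_edges F x z \<union> half_edge x ` {1..6}"
  by (simp add: A_tilde_def new_edges_eq Let_def)

lemma Old_image_eq_iff [simp]: "Old ` e = Old ` f \<longleftrightarrow> e = f"
  by (rule inj_image_eq_iff) (simp add: inj_def)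

lemma half_edge_eq_iff [simp]: "half_edge x i = half_edge x j \<longleftrightarrow> i = j"
  by (auto simp: doubleton_eq_iff)

lemma half_edge_neq_Old_image [simp]: "half_edge x j \<noteq> Old ` e" "Old ` e \<noteq> half_edge x j"
  by blast+

text \<open>The local data of one labelled graph. Distinctness and the position of
  \<open>{z 1, z 2}\<close> outside \<open>F\<close> come from the disjointness of the two circuits,
  see \<open>labelled_factorI\<close>.\<close>

locale labelled_factor =
  fixes Q F :: "'a graph" and x z :: "nat \<Rightarrow> 'a"
  assumes cubic: "cubic Q" and two_factor: "two_factor Q F"
    and F_edges: "{x 1, x 2} \<in> edges F" "{x 2, z 2} \<in> edges F" "{z 2, x 6} \<in> edges F"
      "{x 4, z 1} \<in> edges F" "{z 1, x 5} \<in> edges F"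
    and z_edge: "{z 1, z 2} \<in> edges Q - edges F"
    and distinct: "distinct [x 1, x 2, z 2, x 6, x 4, z 1, x 5]"
begin

abbreviation "Qt \<equiv> Q_tilde Q x z"
abbreviation "Ft \<equiv> A_tilde F x z"

lemma simple: "simple_graph Q"
  using cubic by (simp add: regular_def)

lemma pair: "pair_graph Q"
  using simple by (rule simple_graph_pair_graph)

lemma F_sub: "edges F \<subseteq> edges Q" "verts F = verts Q"
  using two_factor by (auto simp: two_factor_def subgraph_def)

lemma edge_verts: "e \<in> edges Q \<Longrightarrow> e \<subseteq> verts Q"
  using simple by (simp add: simple_graph_def)

lemma card_edge: "e \<in> edges Q \<Longrightarrow> card e = 2"
  using simple by (simp add: simple_graph_def)

lemma neqs: "x 1 \<noteq> x 2" "x 1 \<noteq> z 2" "x 1 \<noteq> x 6" "x 1 \<noteq> x 4" "x 1 \<noteq> z 1" "x 1 \<noteq> x 5"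
  "x 2 \<noteq> z 2" "x 2 \<noteq> x 6" "x 2 \<noteq> x 4" "x 2 \<noteq> z 1" "x 2 \<noteq> x 5"
  "z 2 \<noteq> x 6" "z 2 \<noteq> x 4" "z 2 \<noteq> z 1" "z 2 \<noteq> x 5"
  "x 6 \<noteq> x 4" "x 6 \<noteq> z 1" "x 6 \<noteq> x 5" "x 4 \<noteq> z 1" "x 4 \<noteq> x 5" "z 1 \<noteq> x 5"
  using distinct by simp_all

lemma card_star_F: "v \<in> verts Q \<Longrightarrow> card (star F v) = 2"
  using two_factor by (auto simp: two_factor_def regular_def degree_eq_card_star)

lemma star_F_eqI:
  assumes "e \<in> edges F" "f \<in> edges F" "v \<in> e" "v \<in> f" "e \<noteq> f"
  shows "star F v = {e, f}"
proof -
  have v: "v \<in> verts Q" using assms edge_verts F_sub by blast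
  show ?thesis
    using assms card_star_F[OF v]
    by (intro card_seteq[symmetric]) (auto simp: star_def card_ge_0_finite)
qed

lemma star_z2: "star F (z 2) = {{x 2, z 2}, {z 2, x 6}}"
  by (rule star_F_eqI) (use F_edges neqs in \<open>auto simp: doubleton_eq_iff\<close>)

lemma star_z1: "star F (z 1) = {{x 4, z 1}, {z 1, x 5}}"
  by (rule star_F_eqI) (use F_edges neqs in \<open>auto simp: doubleton_eq_iff\<close>)

lemma star_x2: "star F (x 2) = {{x 1, x 2}, {x 2, z 2}}"
  by (rule star_F_eqI) (use F_edges neqs in \<open>auto simp: doubleton_eq_iff\<close>)

lemma x_verts: "x 1 \<in> verts Q" "x 2 \<in> verts Q" "x 4 \<in> verts Q" "x 5 \<in> verts Q" "x 6 \<in> verts Q"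
  "z 1 \<in> verts Q" "z 2 \<in> verts Q"
  using F_edges F_sub edge_verts by blast+

lemma index_cases: "j \<in> {1..6} \<Longrightarrow> j = 1 \<or> j = 2 \<or> j = 3 \<or> j = 4 \<or> j = 5 \<or> j = (6::nat)"
  by auto

lemma attach_verts: "j \<in> {1..6} \<Longrightarrow> attach x j \<in> verts Q - {z 1, z 2}"
  using index_cases[of j] x_verts neqs by (auto simp: attach_def)

lemma matching_edge:
  assumes "v \<in> verts Q"
  obtains m where "m \<in> edges Q - edges F" "v \<in> m" "star Q v = insert m (star F v)"
  by (rule star_cubic_two_factor[OF cubic two_factor assms])

text \<open>With \<open>matching_edge\<close>: the complement of a 2-factor in a cubic graph is a
  perfect matching.\<close>

lemma matching_edge_unique:
  assumes "m \<in> edges Q - edges F" "m' \<in> edges Q - edges F" "v \<in> m" "v \<in> m'"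
  shows "m = m'"
proof -
  have "v \<in> verts Q" using assms edge_verts by blast
  then obtain n where "n \<in> edges Q - edges F" "v \<in> n" "star Q v = insert n (star F v)"
    by (rule matching_edge)
  moreover have "m \<in> star Q v - star F v" "m' \<in> star Q v - star F v"
    using assms by (simp_all add: star_def)
  ultimately show ?thesis by blast
qed

text \<open>\<open>{z 1, z 2}\<close> is the only matching edge at \<open>z 1\<close> or
  \<open>z 2\<close>, and \<open>{x 1, x 2}\<close> lies in \<open>F\<close>; so opening
  \<open>Q\<close> destroys a single matching edge.\<close>

lemma matching_edge_kept:
  assumes "m \<in> edges Q - edges F"
  shows "m \<in> kept_edges Q x z \<longleftrightarrow> m \<noteq> {z 1, z 2}"
    and "v \<in> m \<Longrightarrow> v \<notin> {z 1, z 2} \<Longrightarrow> m \<in> kept_edges Q x z"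
proof -
  have "z 1 \<in> m \<or> z 2 \<in> m \<Longrightarrow> m = {z 1, z 2}"
    using matching_edge_unique[OF assms z_edge] by blast
  then show "m \<in> kept_edges Q x z \<longleftrightarrow> m \<noteq> {z 1, z 2}"
    using assms F_edges by (auto simp: kept_edges_def)
  then show "v \<in> m \<Longrightarrow> v \<notin> {z 1, z 2} \<Longrightarrow> m \<in> kept_edges Q x z" by blast
qed

lemma kept_edges_Q: "kept_edges F x z = kept_edges Q x z \<inter> edges F"
  using F_sub by (auto simp: kept_edges_def)

lemma edges_Qt_minus_Ft:
  "edges Qt - edges Ft = (`) Old ` (kept_edges Q x z - edges F)"
  by (auto simp: edges_Q_tilde edges_A_tilde kept_edges_Q)

text \<open>A vertex \<open>Y j\<close> meets only its half-edge, which belongs to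
  \<open>Ft\<close>; the colouring condition thus concerns old vertices only.\<close>

lemma face_coloring_tilde_iff:
  "face_coloring Qt Ft c \<longleftrightarrow> (\<forall>u v. {u, v} \<in> kept_edges Q x z - edges F \<longrightarrow>
     card (c ` star Ft (Old u)) = 2 \<and> c ` star Ft (Old u) = c ` star Ft (Old v))"
proof -
  have iff: "{a, b} \<in> edges Qt - edges Ft \<longleftrightarrow>
      (\<exists>u v. a = Old u \<and> b = Old v \<and> {u, v} \<in> kept_edges Q x z - edges F)" for a b
  proof
    assume "{a, b} \<in> edges Qt - edges Ft"
    then obtain m where m: "m \<in> kept_edges Q x z - edges F" "{a, b} = Old ` m"
      unfolding edges_Qt_minus_Ft by auto
    then obtain u v where "a = Old u" "b = Old v" by blast
    then have "Old ` {u, v} = Old ` m" using m by simp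
    then have "{u, v} = m" by (simp only: Old_image_eq_iff)
    with m \<open>a = _\<close> \<open>b = _\<close> show "\<exists>u v. a = Old u \<and> b = Old v \<and> {u, v} \<in> kept_edges Q x z - edges F"
      by blast
  next
    assume "\<exists>u v. a = Old u \<and> b = Old v \<and> {u, v} \<in> kept_edges Q x z - edges F"
    then obtain u v where "{u, v} \<in> kept_edges Q x z - edges F" "{a, b} = Old ` {u, v}" by auto
    then show "{a, b} \<in> edges Qt - edges Ft" unfolding edges_Qt_minus_Ft by blast
  qed
  have "(\<forall>a b. (\<exists>u v. a = Old u \<and> b = Old v \<and> P u v) \<longrightarrow> R a b) \<longleftrightarrow>
      (\<forall>u v. P u v \<longrightarrow> R (Old u) (Old v))"
    for P and R :: "'a tvertex \<Rightarrow> 'a tvertex \<Rightarrow> bool" by blast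
  then show ?thesis
    unfolding face_coloring_def iff .
qed

text \<open>
  The edge \<open>{x 2, z 2}\<close> has no canonical counterpart in \<open>Q\<^sup>~\<close>, because the half-edges
  \<open>e\<^sub>2\<close> and \<open>e\<^sub>3\<close> at \<open>x 2\<close> are interchangeable; its value here is irrelevant.
\<close>

definition lift :: "'a set \<Rightarrow> 'a tvertex set" where
  "lift e = (if e \<in> kept_edges F x z then Old ` e
     else if e = {x 1, x 2} then half_edge x 1
     else if e = {x 4, z 1} then half_edge x 4
     else if e = {z 1, x 5} then half_edge x 5
     else half_edge x 6)"

lemma lift_simps:
  "e \<in> kept_edges F x z \<Longrightarrow> lift e = Old ` e"
  "lift {x 1, x 2} = half_edge x 1" "lift {x 4, z 1} = half_edge x 4"
  "lift {z 1, x 5} = half_edge x 5" "lift {z 2, x 6} = half_edge x 6"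
proof -
  have nk: "{x 1, x 2} \<notin> kept_edges F x z" "{x 4, z 1} \<notin> kept_edges F x z"
    "{z 1, x 5} \<notin> kept_edges F x z" "{z 2, x 6} \<notin> kept_edges F x z"
    by (auto simp: kept_edges_def)
  have ne: "{x 4, z 1} \<noteq> {x 1, x 2}" "{z 1, x 5} \<noteq> {x 1, x 2}" "{z 1, x 5} \<noteq> {x 4, z 1}"
    "{z 2, x 6} \<noteq> {x 1, x 2}" "{z 2, x 6} \<noteq> {x 4, z 1}" "{z 2, x 6} \<noteq> {z 1, x 5}"
    using neqs by (auto simp: doubleton_eq_iff)
  show "e \<in> kept_edges F x z \<Longrightarrow> lift e = Old ` e" by (simp add: lift_def)
  show "lift {x 1, x 2} = half_edge x 1" "lift {x 4, z 1} = half_edge x 4"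
    "lift {z 1, x 5} = half_edge x 5" "lift {z 2, x 6} = half_edge x 6"
    unfolding lift_def using nk ne by (simp_all only: if_False if_True refl)
qed

lemma edges_F_cases:
  assumes "e \<in> edges F"
  obtains "e \<in> kept_edges F x z" | "e = {x 1, x 2}" | "e = {x 4, z 1}" | "e = {z 1, x 5}"
    | "e = {z 2, x 6}" | "e = {x 2, z 2}"
proof -
  have "z 1 \<in> e \<Longrightarrow> e \<in> star F (z 1)" "z 2 \<in> e \<Longrightarrow> e \<in> star F (z 2)"
    using assms by (auto simp: star_def)
  then show thesis
    using that assms unfolding star_z1 star_z2 kept_edges_def by blast
qed

lemma star_Ft:
  "star Ft (Old w) = (`) Old ` (star F w \<inter> kept_edges F x z) \<union> half_edge x ` {j \<in> {1..6}. attach x j = w}"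
  by (auto simp: star_def edges_A_tilde kept_edges_Q)

text \<open>A cut edge is replaced by the half-edge at its surviving end. Only \<open>x 2\<close>
  loses both of its edges of \<open>F\<close>, and there \<open>e_2\<close> and \<open>e_3\<close>
  take their place.\<close>

lemma star_Ft_eq_lift:
  assumes "w \<notin> {x 2, z 1, z 2}"
  shows "star Ft (Old w) = lift ` star F w"
proof (intro equalityI subsetI)
  fix g assume "g \<in> star Ft (Old w)"
  then consider e where "e \<in> star F w" "e \<in> kept_edges F x z" "g = Old ` e"
    | j where "j \<in> {1..6}" "attach x j = w" "g = half_edge x j"
    unfolding star_Ft by blast
  then show "g \<in> lift ` star F w"
  proof cases
    case 1
    then show ?thesis using lift_simps(1) by force
  next
    case 2
    then have "j = 1 \<and> w = x 1 \<or> j = 4 \<and> w = x 4 \<or> j = 5 \<and> w = x 5 \<or> j = 6 \<and> w = x 6"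
      using index_cases[of j] assms by (auto simp: attach_def)
    moreover have "{x 1, x 2} \<in> star F (x 1)" "{x 4, z 1} \<in> star F (x 4)"
      "{z 1, x 5} \<in> star F (x 5)" "{z 2, x 6} \<in> star F (x 6)"
      using F_edges by (auto simp: star_def)
    ultimately show ?thesis
      using 2(3) lift_simps(2-5) by (metis image_eqI)
  qed
next
  fix g assume "g \<in> lift ` star F w"
  then obtain e where e: "e \<in> star F w" "g = lift e" by blast
  then have "e \<in> edges F" "w \<in> e" by (auto simp: star_def)
  from \<open>e \<in> edges F\<close> show "g \<in> star Ft (Old w)"
  proof (cases rule: edges_F_cases)
    case 1
    then show ?thesis using e lift_simps(1) by (auto simp: star_Ft)
  next
    case 2
    with \<open>w \<in> e\<close> assms have "w = x 1" by blast
    with 2 e lift_simps(2) show ?thesis unfolding star_Ft attach_def by auto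
  next
    case 3
    with \<open>w \<in> e\<close> assms have "w = x 4" by blast
    with 3 e lift_simps(3) show ?thesis unfolding star_Ft attach_def by auto
  next
    case 4
    with \<open>w \<in> e\<close> assms have "w = x 5" by blast
    with 4 e lift_simps(4) show ?thesis unfolding star_Ft attach_def by auto
  next
    case 5
    with \<open>w \<in> e\<close> assms have "w = x 6" by blast
    with 5 e lift_simps(5) show ?thesis unfolding star_Ft attach_def by auto
  next
    case 6
    with \<open>w \<in> e\<close> assms show ?thesis by blast
  qed
qed

lemma star_Ft_x2: "star Ft (Old (x 2)) = {half_edge x 2, half_edge x 3}"
proof -
  have "{j \<in> {1..6}. attach x j = x 2} = {2, 3}"
    using neqs index_cases by (fastforce simp: attach_def)
  moreover have "star F (x 2) \<inter> kept_edges F x z = {}"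
    unfolding star_x2 by (auto simp: kept_edges_def)
  ultimately show ?thesis unfolding star_Ft by simp
qed

text \<open>The upper bound is enough: once two colours appear at a vertex, it forces the colouring
  to be injective there.\<close>

lemma card_star_Ft_le:
  assumes "w \<in> verts Q - {z 1, z 2}"
  shows "finite (star Ft (Old w))" "card (star Ft (Old w)) \<le> 2"
proof -
  have "finite (star Ft (Old w)) \<and> card (star Ft (Old w)) \<le> 2"
  proof (cases "w = x 2")
    case True
    then show ?thesis using star_Ft_x2 by (simp add: card_insert_if)
  next
    case False
    then have "star Ft (Old w) = lift ` star F w" using assms star_Ft_eq_lift by blast
    moreover have "card (star F w) = 2" using assms card_star_F by blast
    ultimately show ?thesis
      using card_image_le[of "star F w" lift] card_ge_0_finite[of "star F w"] by simp
  qed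
  then show "finite (star Ft (Old w))" "card (star Ft (Old w)) \<le> 2" by auto
qed

text \<open>Every remaining vertex keeps its matching edge, so the condition applies at each of
  them.\<close>

lemma face_coloring_tilde_at:
  assumes "face_coloring Qt Ft c" "w \<in> verts Q - {z 1, z 2}"
  shows "card (c ` star Ft (Old w)) = 2" "inj_on c (star Ft (Old w))"
proof -
  from assms obtain m where m: "m \<in> edges Q - edges F" "w \<in> m" using matching_edge by blast
  then obtain a b where "m = {a, b}" using pair by (auto simp: pair_graph_def)
  with m(2) have "m = {w, if w = a then b else a}" by auto
  moreover have "m \<in> kept_edges Q x z - edges F" using matching_edge_kept(2) m assms(2) by blast
  ultimately show two: "card (c ` star Ft (Old w)) = 2"
    using assms(1) unfolding face_coloring_tilde_iff by blast
  show "inj_on c (star Ft (Old w))"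
    using card_star_Ft_le[OF assms(2)] two card_image_le[of "star Ft (Old w)" c]
    by (intro eq_card_imp_inj_on) auto
qed

lemma half_edges_2_3_neq:
  assumes "face_coloring Qt Ft c"
  shows "c (half_edge x 2) \<noteq> c (half_edge x 3)"
proof -
  have "x 2 \<in> verts Q - {z 1, z 2}" using x_verts neqs by auto
  from face_coloring_tilde_at(1)[OF assms this] show ?thesis
    unfolding star_Ft_x2 by auto
qed

text \<open>The remaining vertices that see the colour \<open>k\<close> are paired by the matching,
  so their number is even. Each of them lies on one edge of colour \<open>k\<close>; a kept edge
  covers two of them, a half-edge one.\<close>

lemma even_color_class:
  assumes col: "face_coloring Qt Ft c"
  shows "even (card {j \<in> {1..6}. c (half_edge x j) = k})"
proof -
  define U where "U = {w \<in> verts Q - {z 1, z 2}. k \<in> c ` star Ft (Old w)}"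
  have finQ: "finite (verts Q)" "finite (edges Q)"
    using simple finite_subset[of "edges Q" "Pow (verts Q)"] by (auto simp: simple_graph_def)
  have finU: "finite U" using finQ by (simp add: U_def)
  \<comment> \<open>The matching edges meeting \<open>U\<close>. Their two ends see equal colours,
    so they stay inside \<open>U\<close> and pair up its vertices.\<close>
  define T where "T = {m \<in> kept_edges Q x z - edges F. m \<inter> U \<noteq> {}}"
  have keptQ: "kept_edges Q x z \<subseteq> edges Q" by (auto simp: kept_edges_def)
  have finT: "finite T" using finQ keptQ by (auto simp: T_def intro: finite_subset)
  have T_sub: "m \<subseteq> U" if "m \<in> T" for m
  proof -
    from that have m: "m \<in> kept_edges Q x z - edges F" "m \<in> edges Q" using keptQ by (auto simp: T_def)
    then obtain a b where ab: "m = {a, b}" using pair by (auto simp: pair_graph_def)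
    then have "c ` star Ft (Old a) = c ` star Ft (Old b)"
      using col m(1) unfolding face_coloring_tilde_iff by blast
    moreover have "m \<subseteq> verts Q - {z 1, z 2}"
      using edge_verts[OF m(2)] m(1) by (auto simp: kept_edges_def)
    ultimately show ?thesis using that ab unfolding T_def U_def by auto
  qed
  have "card {w \<in> U. w \<in> m} = 2" if "m \<in> T" for m
  proof -
    have "{w \<in> U. w \<in> m} = m" using T_sub[OF that] by blast
    then show ?thesis using card_edge that keptQ by (auto simp: T_def)
  qed
  then have "(\<Sum>w\<in>U. card {m \<in> T. w \<in> m}) = 2 * card T"
    using sum_multicount[OF finU finT] by blast
  moreover have "card {m \<in> T. w \<in> m} = 1" if w: "w \<in> U" for w
  proof -
    have wQ: "w \<in> verts Q - {z 1, z 2}" using w by (simp add: U_def)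
    then obtain m where m: "m \<in> edges Q - edges F" "w \<in> m" using matching_edge by blast
    have "m \<in> kept_edges Q x z" using matching_edge_kept(2)[OF m] wQ by blast
    then have "m \<in> T" using m w by (auto simp: T_def)
    moreover have "n = m" if "n \<in> T" "w \<in> n" for n
      using that(1) keptQ by (intro matching_edge_unique[OF _ m(1) that(2) m(2)]) (auto simp: T_def)
    ultimately have "{n \<in> T. w \<in> n} = {m}" using m(2) by blast
    then show ?thesis by simp
  qed
  ultimately have cardU: "card U = 2 * card T" by simp
  define A where "A = {e \<in> kept_edges F x z. c (Old ` e) = k}"
  define J where "J = {j \<in> {1..6}. c (half_edge x j) = k}"
  define B where "B = (`) Old ` A \<union> half_edge x ` J"
  have keptF: "A \<subseteq> edges Q" using keptQ by (auto simp: A_def kept_edges_Q)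
  have finA: "finite A" using finQ keptF by (auto intro: finite_subset)
  have finJ: "finite J" by (simp add: J_def)
  have finB: "finite B" using finA finJ by (simp add: B_def)
  have B_eq: "B = {g \<in> edges Ft. c g = k}" by (auto simp: B_def A_def J_def edges_A_tilde)
  have starB: "{g \<in> B. Old w \<in> g} = {g \<in> star Ft (Old w). c g = k}" for w
    by (auto simp: B_eq star_def)
  have memU: "w \<in> U" if "g \<in> B" "Old w \<in> g" "w \<in> verts Q - {z 1, z 2}" for g w
    using that by (auto simp: U_def B_eq star_def)
  have "card {g \<in> B. Old w \<in> g} = 1" if w: "w \<in> U" for w
  proof -
    obtain g where g: "g \<in> star Ft (Old w)" "c g = k" using w by (auto simp: U_def)
    have "inj_on c (star Ft (Old w))" using face_coloring_tilde_at(2)[OF col] w by (simp add: U_def)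
    then have "{g \<in> star Ft (Old w). c g = k} = {g}" using g by (auto dest: inj_onD)
    then show ?thesis unfolding starB by simp
  qed
  then have "card U = (\<Sum>w\<in>U. card {g \<in> B. Old w \<in> g})" by simp
  also have "\<dots> = (\<Sum>g\<in>B. card {w \<in> U. Old w \<in> g})"
    using sum_multicount_gen[OF finU finB, of "\<lambda>w g. Old w \<in> g"] by simp
  also have "\<dots> = (\<Sum>g\<in>(`) Old ` A. card {w \<in> U. Old w \<in> g}) + (\<Sum>g\<in>half_edge x ` J. card {w \<in> U. Old w \<in> g})"
    unfolding B_def using finA finJ by (intro sum.union_disjoint) auto
  also have "(\<Sum>g\<in>(`) Old ` A. card {w \<in> U. Old w \<in> g}) = (\<Sum>g\<in>(`) Old ` A. 2)"
  proof (rule sum.cong[OF refl])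
    fix g assume "g \<in> (`) Old ` A"
    then obtain e where e: "e \<in> A" "g = Old ` e" by blast
    then have eQ: "e \<subseteq> verts Q - {z 1, z 2}" "e \<in> edges Q"
      using keptF edge_verts[of e] by (auto simp: A_def kept_edges_def)
    have "g \<in> B" using e by (auto simp: B_def)
    then have "{w \<in> U. Old w \<in> g} = e" using e eQ memU[of g] by auto
    then show "card {w \<in> U. Old w \<in> g} = 2" using card_edge eQ by simp
  qed
  also have "(\<Sum>g\<in>half_edge x ` J. card {w \<in> U. Old w \<in> g}) = (\<Sum>g\<in>half_edge x ` J. 1)"
  proof (rule sum.cong[OF refl])
    fix g assume g: "g \<in> half_edge x ` J"
    then obtain j where j: "j \<in> J" "g = half_edge x j" by blast
    have "g \<in> B" using g by (auto simp: B_def)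
    then have "attach x j \<in> U" using memU[of g "attach x j"] j attach_verts[of j] by (simp add: J_def)
    then have "{w \<in> U. Old w \<in> g} = {attach x j}" using j by auto
    then show "card {w \<in> U. Old w \<in> g} = 1" by simp
  qed
  also have "(\<Sum>g\<in>half_edge x ` J. 1) = card J"
    by (simp add: card_image inj_on_def)
  finally have "2 * card T = 2 * card ((`) Old ` A) + card J" using cardU by simp
  then have "even (2 * card ((`) Old ` A) + card J)" by (metis dvd_triv_left)
  then show ?thesis unfolding J_def by simp
qed

text \<open>\<open>t\<close> becomes the colour of \<open>{x 2, z 2}\<close>; the other cut edges
  inherit the colours of \<open>e_1\<close>, \<open>e_4\<close>, \<open>e_5\<close>,
  \<open>e_6\<close>. The assumption \<open>x2\<close> preserves the set of colours at
  \<open>x 2\<close>, and the assumptions \<open>z\<close> are the condition at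
  \<open>{z 1, z 2}\<close>.\<close>

lemma contained_if_tilde_coloring:
  assumes col: "face_coloring Qt Ft c"
    and x2: "{c (half_edge x 1), t} = {c (half_edge x 2), c (half_edge x 3)}"
    and z: "t \<noteq> c (half_edge x 6)" "{t, c (half_edge x 6)} = {c (half_edge x 4), c (half_edge x 5)}"
  shows "contained_in_some_cdc Q F"
proof -
  \<comment> \<open>Overrides the arbitrary value that \<open>lift\<close> gives to
    \<open>{x 2, z 2}\<close>.\<close>
  define c' where "c' e = (if e = {x 2, z 2} then t else c (lift e))" for e
  have ne: "{x 1, x 2} \<noteq> {x 2, z 2}" "{z 2, x 6} \<noteq> {x 2, z 2}" "{x 4, z 1} \<noteq> {x 2, z 2}"
    "{z 1, x 5} \<noteq> {x 2, z 2}"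
    using neqs by (auto simp: doubleton_eq_iff)
  have at: "c' ` star F w = c ` star Ft (Old w)" if w: "w \<notin> {z 1, z 2}" for w
  proof (cases "w = x 2")
    case True
    have "c' {x 1, x 2} = c (half_edge x 1)" "c' {x 2, z 2} = t"
      using ne lift_simps by (simp_all add: c'_def)
    then show ?thesis using True x2 by (simp add: star_x2 star_Ft_x2)
  next
    case False
    then have "c' e = c (lift e)" if "e \<in> star F w" for e
      using that w by (auto simp: c'_def star_def)
    then have "c' ` star F w = c ` (lift ` star F w)" by (auto simp: image_image)
    then show ?thesis using star_Ft_eq_lift False w by simp
  qed
  have z2: "c' ` star F (z 2) = {t, c (half_edge x 6)}"
    using ne lift_simps(5) by (simp add: star_z2 c'_def insert_commute)
  have z1: "c' ` star F (z 1) = {c (half_edge x 4), c (half_edge x 5)}"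
    using ne lift_simps(3,4) unfolding star_z1 c'_def by simp
  have "face_coloring Q F c'"
    unfolding face_coloring_def
  proof (intro allI impI)
    fix u v assume uv: "{u, v} \<in> edges Q - edges F"
    show "card (c' ` star F u) = 2 \<and> c' ` star F u = c' ` star F v"
    proof (cases "{u, v} = {z 1, z 2}")
      case True
      then have "c' ` star F u = {t, c (half_edge x 6)}" "c' ` star F v = {t, c (half_edge x 6)}"
        using z1 z2 z(2) by (auto simp: doubleton_eq_iff)
      then show ?thesis using z(1) by simp
    next
      case False
      then have kept: "{u, v} \<in> kept_edges Q x z" using matching_edge_kept(1)[OF uv] by blast
      then have "u \<notin> {z 1, z 2}" "v \<notin> {z 1, z 2}" by (auto simp: kept_edges_def)
      then show ?thesis
        using at col kept uv unfolding face_coloring_tilde_iff by auto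
    qed
  qed
  then show ?thesis by (rule contained_in_some_cdc_if_face_coloring[OF cubic two_factor])
qed

end


section \<open>Colour patterns on six half-edges and their incompatibility\<close>

section \<open>Colours of the half-edges\<close>

text \<open>
  The patterns of the colours \<open>k1, \<dots>, k6\<close> of the half-edges \<open>e\<^sub>1, \<dots>, e\<^sub>6\<close> that remain when every
  colour occurs an even number of times and the colouring does not extend to \<open>Q\<close>; in an
  extension, \<open>x 1 x 2\<close> inherits \<open>k1\<close> and \<open>x 2 z 2\<close> gets the remaining colour at \<open>x 2\<close>.
\<close>

definition admissible :: "'c \<Rightarrow> 'c \<Rightarrow> 'c \<Rightarrow> 'c \<Rightarrow> 'c \<Rightarrow> 'c \<Rightarrow> bool" where
  "admissible k1 k2 k3 k4 k5 k6 \<longleftrightarrow> k2 \<noteq> k3 \<and>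
     ((k1 \<noteq> k6 \<and> (\<exists>s. (s = k2 \<and> k6 = k3 \<or> s = k3 \<and> k6 = k2) \<and>
         (k1 = s \<and> k4 = k5 \<or> k1 = k4 \<and> s = k5 \<or> k1 = k5 \<and> s = k4))) \<or>
      (k1 = k6 \<and> k1 \<noteq> k2 \<and> k1 \<noteq> k3 \<and> (k4 = k2 \<and> k5 = k3 \<or> k4 = k3 \<and> k5 = k2)))"

text \<open>If \<open>k 6\<close> differs from \<open>k 1\<close>, \<open>k 2\<close>,
  \<open>k 3\<close>, parity puts it among \<open>k 4\<close>, \<open>k 5\<close>, makes
  \<open>k 1\<close> one of \<open>k 2\<close>, \<open>k 3\<close>, and the other of them completes
  \<open>{k 4, k 5}\<close>: the extension excluded by \<open>bad\<close>. The case of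
  \<open>k 1 = k 6\<close> in \<open>{k 2, k 3}\<close> is similar.\<close>

lemma admissible_half_edge_colors:
  fixes k :: "nat \<Rightarrow> 'c"
  assumes even: "\<And>a. even (card {j \<in> {1..6}. k j = a})"
    and neq: "k 2 \<noteq> k 3"
    and bad: "\<And>t. {k 1, t} = {k 2, k 3} \<Longrightarrow> t \<noteq> k 6 \<Longrightarrow> {t, k 6} \<noteq> {k 4, k 5}"
  shows "admissible (k 1) (k 2) (k 3) (k 4) (k 5) (k 6)"
proof -
  have card_eq: "card {j \<in> {1..6}. k j = a} = of_bool (k 1 = a) + of_bool (k 2 = a) + of_bool (k 3 = a)
      + of_bool (k 4 = a) + of_bool (k 5 = a) + of_bool (k 6 = a)" for a
  proof -
    have "card {j \<in> {1..6}. k j = a} = (\<Sum>j\<in>{1..6}. of_bool (k j = a))"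
      by (simp add: sum_of_bool_eq Int_def)
    also have "\<dots> = (\<Sum>j\<in>{1, 2, 3, 4, 5, 6}. of_bool (k j = a))"
      by (rule sum.cong) auto
    also have "\<dots> = of_bool (k 1 = a) + of_bool (k 2 = a) + of_bool (k 3 = a)
      + of_bool (k 4 = a) + of_bool (k 5 = a) + of_bool (k 6 = a)"
      by (simp add: add.assoc)
    finally show ?thesis .
  qed
  note sum = even[unfolded card_eq]

  \<comment> \<open>A chain of equivalences holds iff an even number of its terms are false; with
    six terms, iff an even number are true.\<close>
  have xor: "(k 1 = a) = ((k 2 = a) = ((k 3 = a) = ((k 4 = a) = ((k 5 = a) = (k 6 = a)))))" for a
    using sum[of a]
    by (cases "k 1 = a"; cases "k 2 = a"; cases "k 3 = a"; cases "k 4 = a"; cases "k 5 = a";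
        cases "k 6 = a"; simp)
  define k1 k2 k3 k4 k5 k6 where k_defs: "k1 = k 1" "k2 = k 2" "k3 = k 3" "k4 = k 4" "k5 = k 5" "k6 = k 6"
  \<comment> \<open>Since \<open>k 2\<close> and \<open>k 3\<close> differ, \<open>t\<close> can
    only be the one of them that is not \<open>k 1\<close>.\<close>
  have bads: "k1 = k2 \<Longrightarrow> k3 \<noteq> k6 \<Longrightarrow> {k3, k6} \<noteq> {k4, k5}" "k1 = k3 \<Longrightarrow> k2 \<noteq> k6 \<Longrightarrow> {k2, k6} \<noteq> {k4, k5}"
    using bad[of "k 2"] bad[of "k 3"] by (simp_all add: k_defs insert_commute)
  note S = xor[folded k_defs]
  have "k2 \<noteq> k3" using neq by (simp add: k_defs)
  show ?thesis
    unfolding k_defs[symmetric] admissible_def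
    using bads[unfolded doubleton_eq_iff] \<open>k2 \<noteq> k3\<close> S[of k1] S[of k2] S[of k3] S[of k4] S[of k5] S[of k6]
    by (smt (z3))
qed

text \<open>\<open>a\<close> to \<open>h\<close> colour the edges between consecutive copies in the
  cyclic order 1, 4, 3, 2; \<open>m\<close> and \<open>n\<close> those between opposite copies; the
  others the edges at \<open>Vp\<close> and \<open>Vq\<close>. In a copy let X be the colour at
  \<open>Vp\<close> or \<open>Vq\<close> and Y that of \<open>e_6\<close>. If X = Y, the outgoing
  pair avoids Y, and it equals the incoming pair \<open>e_4\<close>, \<open>e_5\<close> or both are
  monochromatic; otherwise the outgoing pair has two colours, one of them Y. As \<open>p1\<close>
  and \<open>p3\<close> differ, the latter occurs somewhere, so no pair around the cycle is
  monochromatic. Then the incoming pair always avoids Y, and if X differs from Y it contains X,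
  which is replaced by Y. Going once around, \<open>p1\<close>, \<open>p3\<close>,
  \<open>q2\<close>, \<open>q4\<close> are \<open>m\<close>, \<open>m\<close>, \<open>n\<close>,
  \<open>n\<close> in some order. So one odd and one even copy change nothing, while the other two
  replace \<open>n\<close> by \<open>m\<close> and \<open>m\<close> by \<open>n\<close>; one of the
  unchanged pairs then contains the Y of its copy.\<close>

lemma admissible_gluing_contradiction:
  fixes a b c d e f g h m n p1 p3 q2 q4 :: 'c
  assumes "admissible a p1 b g h m" "admissible c d q4 a b n" "admissible e p3 f c d m" "admissible g h q2 e f n"
   "p1 \<noteq> p3" "{p1, p3} = {q2, q4}"
  shows False
  using assms unfolding admissible_def doubleton_eq_iff by (smt (verit))


section \<open>Edges of \<open>H\<close> as images of edges of the four opened graphs\<close>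

section \<open>The graph \<open>H\<close>\<close>

lemma edges_graph_H:
  "edges (graph_H Qs x z) =
     (\<Union>i\<in>{1..4}. (`) (into_H x i) ` edges (Q_tilde (Qs i) (x i) (z i))) \<union> {{Vp, Vq}}"
  by (simp add: graph_H_def graph_Union_def graph_image_def Let_def)

lemma edges_factor_F:
  "edges (factor_F Fs x z) =
     (\<Union>i\<in>{1..4}. (`) (into_H x i) ` edges (A_tilde (Fs i) (x i) (z i)))"
  by (simp add: factor_F_def A_H_def graph_Union_def graph_image_def)

lemma into_H_eq_Vp: "into_H x i t = Vp \<longleftrightarrow> t = Y 2 \<and> (i = 1 \<or> i = 3)"
  by (cases t) (auto split: prod.split)

lemma into_H_eq_Vq: "into_H x i t = Vq \<longleftrightarrow> t = Y 3 \<and> (i = 2 \<or> i = 4)"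
  by (cases t) (auto split: prod.split)

text \<open>\<open>partner\<close> is an involution that always leads to another copy, so a glued
  edge is the image of either of its half-edges.\<close>

lemma into_H_Y_eq_Copy:
  assumes "k \<in> {1..4}" "j \<in> {1..6}" "into_H x k (Y j) = Copy i v"
  obtains l where "l \<in> {1..6}" "i \<noteq> k" "v = attach (x i) l" "into_H x i (Y l) = Copy k (attach (x k) j)"
proof -
  have k: "k = 1 \<or> k = 2 \<or> k = 3 \<or> k = 4" using assms(1) by auto
  have j: "j = 1 \<or> j = 2 \<or> j = 3 \<or> j = 4 \<or> j = 5 \<or> j = 6" using assms(2) by auto
  have "snd (partner (k, j)) \<in> {1..6} \<and> i \<noteq> k \<and> v = attach (x i) (snd (partner (k, j))) \<and>
      into_H x i (Y (snd (partner (k, j)))) = Copy k (attach (x k) j)"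
    using k j assms(3) by (elim disjE) (simp_all add: partner_def gluing_def, auto)
  then show thesis using that by blast
qed

lemma into_H_image_half_edge:
  "into_H x i ` half_edge (x i) j = {Copy i (attach (x i) j), into_H x i (Y j)}"
  by simp

lemma into_H_image_Old: "into_H x i ` Old ` e = Copy i ` e"
  by (simp add: image_image)

text \<open>An edge contributed by another copy that ends in copy \<open>i\<close> is glued, hence
  also the image of a half-edge of copy \<open>i\<close>. \<open>K k\<close> stands for the kept
  edges of copy \<open>k\<close>.\<close>

lemma star_Copy:
  assumes "i \<in> {1..4}"
  shows "{e \<in> (\<Union>k\<in>{1..4}. (`) (into_H x k) ` ((`) Old ` K k \<union> half_edge (x k) ` {1..6})). Copy i v \<in> e} =
    (`) (into_H x i) ` {e \<in> (`) Old ` K i \<union> half_edge (x i) ` {1..6}. Old v \<in> e}" (is "?L = ?R")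
proof (intro equalityI subsetI)
  fix e assume "e \<in> ?L"
  then have v: "Copy i v \<in> e" by blast
  from \<open>e \<in> ?L\<close> consider (kept) k f where "k \<in> {1..4}" "f \<in> K k" "e = Copy k ` f"
    | (half) k j where "k \<in> {1..4}" "j \<in> {1..6}" "e = {Copy k (attach (x k) j), into_H x k (Y j)}"
    by (force simp: into_H_image_Old)
  then show "e \<in> ?R"
  proof cases
    case kept
    then have "k = i" "v \<in> f" using v by auto
    with kept have "e = into_H x i ` Old ` f" "Old ` f \<in> {e \<in> (`) Old ` K i \<union> half_edge (x i) ` {1..6}. Old v \<in> e}"
      by (auto simp: into_H_image_Old)
    then show ?thesis by blast
  next
    case half
    show ?thesis
    proof (cases "Copy i v = Copy k (attach (x k) j)")
      case True
      with half have "e = into_H x i ` half_edge (x i) j"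
        "half_edge (x i) j \<in> {e \<in> (`) Old ` K i \<union> half_edge (x i) ` {1..6}. Old v \<in> e}"
        by auto
      then show ?thesis by blast
    next
      case False
      with half v have "into_H x k (Y j) = Copy i v" by auto
      with half(1,2) obtain l where l: "l \<in> {1..6}" "i \<noteq> k" "v = attach (x i) l"
        "into_H x i (Y l) = Copy k (attach (x k) j)" by (rule into_H_Y_eq_Copy)
      have "e = {Copy k (attach (x k) j), Copy i v}" using half(3) \<open>into_H x k (Y j) = Copy i v\<close> by simp
      also have "\<dots> = into_H x i ` half_edge (x i) l"
        unfolding into_H_image_half_edge l(3,4) by (rule insert_commute)
      finally have "e = into_H x i ` half_edge (x i) l" .
      moreover have "half_edge (x i) l \<in> {e \<in> (`) Old ` K i \<union> half_edge (x i) ` {1..6}. Old v \<in> e}"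
        using l by auto
      ultimately show ?thesis by blast
    qed
  qed
next
  fix e assume "e \<in> ?R"
  then obtain g where g: "g \<in> (`) Old ` K i \<union> half_edge (x i) ` {1..6}" "Old v \<in> g" "e = into_H x i ` g"
    by blast
  have "into_H x i (Old v) \<in> e" using g by blast
  then have "Copy i v \<in> e" by simp
  with g assms show "e \<in> ?L" by blast
qed

section \<open>Transfer of colourings from \<open>H\<close> to its four copies\<close>

locale superposition =
  fixes Qs Fs :: "nat \<Rightarrow> 'a graph" and x z :: "nat \<Rightarrow> nat \<Rightarrow> 'a"
  assumes factors: "i \<in> {1..4} \<Longrightarrow> labelled_factor (Qs i) (Fs i) (x i) (z i)"
begin

abbreviation "H \<equiv> graph_H Qs x z"
abbreviation "FH \<equiv> factor_F Fs x z"
abbreviation "Qts i \<equiv> Q_tilde (Qs i) (x i) (z i)"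
abbreviation "Fts i \<equiv> A_tilde (Fs i) (x i) (z i)"
abbreviation "inner i \<equiv> kept_edges (Qs i) (x i) (z i) - edges (Fs i)"

lemma star_FH_Copy:
  assumes "i \<in> {1..4}"
  shows "star FH (Copy i v) = (`) (into_H x i) ` star (Fts i) (Old v)"
  unfolding star_def edges_factor_F edges_A_tilde by (rule star_Copy[OF assms])

lemma edge_H_cases:
  assumes "e \<in> edges H"
  obtains "e \<in> edges FH" | "e = {Vp, Vq}" | i m where "i \<in> {1..4}" "m \<in> inner i" "e = Copy i ` m"
proof -
  have split: "edges (Qts i) \<subseteq> edges (Fts i) \<union> (`) Old ` inner i" if "i \<in> {1..4}" for i
    using labelled_factor.edges_Qt_minus_Ft[OF factors[OF that]] by blast
  from assms consider "e = {Vp, Vq}" | i g where "i \<in> {1..4}" "g \<in> edges (Qts i)" "e = into_H x i ` g"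
    unfolding edges_graph_H by blast
  then show thesis
  proof cases
    case 1
    then show thesis by (rule that)
  next
    case (2 i g)
    with split[OF 2(1)] consider "g \<in> edges (Fts i)" | m where "m \<in> inner i" "g = Old ` m" by blast
    then show thesis
    proof cases
      case 1
      with 2 have "e \<in> edges FH" unfolding edges_factor_F by blast
      then show thesis by (rule that)
    next
      case (2 m)
      with \<open>e = _\<close> \<open>i \<in> _\<close> show thesis by (intro that(3)) (simp_all add: into_H_image_Old)
    qed
  qed
qed

lemma edge_FH_cases:
  assumes "e \<in> edges FH"
  obtains i f where "i \<in> {1..4}" "f \<in> kept_edges (Fs i) (x i) (z i)" "e = Copy i ` f"
    | i j where "i \<in> {1..4}" "j \<in> {1..6}" "e = {Copy i (attach (x i) j), into_H x i (Y j)}"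
proof -
  from assms obtain i g where ig: "i \<in> {1..4}" "g \<in> edges (Fts i)" "e = into_H x i ` g"
    unfolding edges_factor_F by blast
  then consider f where "f \<in> kept_edges (Fs i) (x i) (z i)" "g = Old ` f"
    | j where "j \<in> {1..6}" "g = half_edge (x i) j" unfolding edges_A_tilde by blast
  then show thesis
  proof cases
    case (1 f)
    with ig show thesis by (intro that(1)) (simp_all add: into_H_image_Old)
  next
    case (2 j)
    have "e = {Copy i (attach (x i) j), into_H x i (Y j)}"
      unfolding ig(3) 2(2) by (rule into_H_image_half_edge)
    then show thesis by (rule that(2)[OF ig(1) 2(1)])
  qed
qed

lemma inner_edge:
  assumes "i \<in> {1..4}" "m \<in> inner i"
  shows "m \<in> edges (Qs i) - edges (Fs i)" "\<exists>a b. m = {a, b}"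
proof -
  interpret labelled_factor "Qs i" "Fs i" "x i" "z i" using factors[OF assms(1)] .
  show "m \<in> edges (Qs i) - edges (Fs i)" using assms by (auto simp: kept_edges_def)
  then show "\<exists>a b. m = {a, b}" using pair by (auto simp: pair_graph_def)
qed

text \<open>Every edge of the factor has an end in some copy.\<close>

lemma PQ_edge: "{Vp, Vq} \<in> edges H - edges FH"
proof -
  have "{Vp, Vq} \<notin> edges FH"
  proof
    assume "{Vp, Vq} \<in> edges FH"
    then show False
    proof (cases rule: edge_FH_cases)
      case (1 i f)
      then have "Vp \<in> Copy i ` f" by (metis insertI1)
      then show False by blast
    next
      case (2 i j)
      then have "Copy i (attach (x i) j) \<in> {Vp, Vq}" by (metis insertI1)
      then show False by blast
    qed
  qed
  then show ?thesis by (simp add: edges_graph_H)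
qed

text \<open>A glued edge joins different copies, so it cannot coincide with an edge inside
  one.\<close>

lemma inner_edge_H:
  assumes i: "i \<in> {1..4}" and m: "m \<in> inner i"
  shows "Copy i ` m \<in> edges H - edges FH"
proof -
  have "Old ` m \<in> edges (Qts i)" using m by (simp add: edges_Q_tilde)
  then have "into_H x i ` Old ` m \<in> edges H" using i unfolding edges_graph_H by blast
  then have "Copy i ` m \<in> edges H" by (simp only: into_H_image_Old)
  obtain v where v: "v \<in> m" using inner_edge(2)[OF assms] by blast
  moreover have "Copy i ` m \<notin> edges FH"
  proof
    assume "Copy i ` m \<in> edges FH"
    then show False
    proof (cases rule: edge_FH_cases)
      case (1 k f)
      then have "Copy i v \<in> Copy k ` f" using v by blast
      then have "k = i" by blast
      then have "m = f" using 1(3) inj_image_eq_iff[of "Copy i" m f] by (simp add: inj_def)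
      then show False using m 1(2) \<open>k = i\<close> by (auto simp: kept_edges_def)
    next
      case (2 k j)
      then have "Copy k (attach (x k) j) \<in> Copy i ` m" "into_H x k (Y j) \<in> Copy i ` m" by auto
      then obtain w where "k = i" "into_H x k (Y j) = Copy i w" by blast
      with 2(1,2) show False by (metis into_H_Y_eq_Copy)
    qed
  qed
  ultimately show ?thesis using \<open>Copy i ` m \<in> edges H\<close> by blast
qed

text \<open>The matchings inside the copies together with \<open>{Vp, Vq}\<close> form a matching of
  \<open>H\<close>. This supplies the hypothesis \<open>cubic_at\<close> of
  \<open>face_coloring_from_cdc\<close>.\<close>

lemma non_FH_edge_unique:
  assumes "e \<in> edges H - edges FH" "e' \<in> edges H - edges FH" "u \<in> e" "u \<in> e'"
  shows "e = e'"
proof -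
  have cases: "g = {Vp, Vq} \<or> (\<exists>i m. i \<in> {1..4} \<and> m \<in> inner i \<and> g = Copy i ` m)"
    if "g \<in> edges H - edges FH" for g
  proof -
    from that have "g \<in> edges H" by simp
    then show ?thesis by (rule edge_H_cases) (use that in blast)+
  qed
  show ?thesis
  proof (cases "u = Vp \<or> u = Vq")
    case True
    then have "g = {Vp, Vq}" if "g \<in> edges H - edges FH" "u \<in> g" for g
      using cases[OF that(1)] that(2) by blast
    with assms show ?thesis by metis
  next
    case False
    then obtain i m where im: "i \<in> {1..4}" "m \<in> inner i" "e = Copy i ` m"
      using cases[OF assms(1)] assms(3) by blast
    obtain k n where kn: "k \<in> {1..4}" "n \<in> inner k" "e' = Copy k ` n"
      using False cases[OF assms(2)] assms(4) by blast
    obtain v where v: "v \<in> m" "v \<in> n" and "k = i" using assms(3,4) im(3) kn(3) by blast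
    have "n \<in> inner i" using kn(2) \<open>k = i\<close> by simp
    then have "m = n"
      using labelled_factor.matching_edge_unique[OF factors[OF im(1)] inner_edge(1)[OF im(1,2)] _ v]
        inner_edge(1)[OF im(1)] by blast
    then show ?thesis using im kn \<open>k = i\<close> by simp
  qed
qed

lemma edges_Qt_verts:
  assumes "i \<in> {1..4}" "g \<in> edges (Qts i)"
  shows "g \<subseteq> verts (Qts i)" "\<exists>a b. g = {a, b}"
proof -
  interpret labelled_factor "Qs i" "Fs i" "x i" "z i" using factors[OF assms(1)] .
  from assms(2) consider f where "f \<in> kept_edges (Qs i) (x i) (z i)" "g = Old ` f"
    | j where "j \<in> {1..6}" "g = half_edge (x i) j" unfolding edges_Q_tilde by blast
  then have "g \<subseteq> verts (Qts i) \<and> (\<exists>a b. g = {a, b})"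
  proof cases
    case (1 f)
    then have "f \<in> edges (Qs i)" "z i 1 \<notin> f" "z i 2 \<notin> f" by (auto simp: kept_edges_def)
    moreover from this have "f \<subseteq> verts (Qs i)" "\<exists>a b. f = {a, b}" using pair unfolding pair_graph_def by metis+
    ultimately show ?thesis using 1(2) by (auto simp: Q_tilde_def)
  next
    case (2 j)
    then show ?thesis using attach_verts[of j] by (auto simp: Q_tilde_def)
  qed
  then show "g \<subseteq> verts (Qts i)" "\<exists>a b. g = {a, b}" by auto
qed

lemma verts_H: "verts H = (\<Union>i\<in>{1..4}. into_H x i ` verts (Qts i))"
  by (simp add: graph_H_def graph_Union_def graph_image_def Let_def)

lemma pair_graph_H: "pair_graph H"
  unfolding pair_graph_def
proof
  fix e assume "e \<in> edges H"
  then consider "e = {Vp, Vq}" | i g where "i \<in> {1..4}" "g \<in> edges (Qts i)" "e = into_H x i ` g"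
    unfolding edges_graph_H by blast
  then show "e \<subseteq> verts H \<and> (\<exists>a b. e = {a, b})"
  proof cases
    case 1
    have mem: "into_H x i (Y j) \<in> verts H" if "i \<in> {1..4}" "j \<in> {1..6}" for i j
      using that unfolding verts_H by (intro UN_I[OF that(1)] imageI) (simp add: Q_tilde_def)
    have "Vp \<in> verts H" "Vq \<in> verts H" using mem[of 1 2] mem[of 2 3] by simp_all
    with 1 show ?thesis by blast
  next
    case (2 i g)
    from edges_Qt_verts[OF 2(1,2)] obtain a b where "g = {a, b}" "g \<subseteq> verts (Qts i)" by blast
    with 2 show ?thesis unfolding verts_H by auto
  qed
qed

lemma face_coloring_H:
  assumes "cdc H S" "FH \<in> S"
  obtains c :: "'a hvertex set \<Rightarrow> 'a hvertex graph" where "face_coloring H FH c"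
proof (rule face_coloring_from_cdc[OF pair_graph_H assms])
  fix e u assume e: "e \<in> star H u - edges FH"
  show "star H u \<subseteq> insert e (star FH u)"
  proof
    fix g assume "g \<in> star H u"
    with e show "g \<in> insert e (star FH u)"
      using non_FH_edge_unique[of e g u] by (auto simp: star_def)
  qed
qed (rule that)

lemma face_coloring_Qt:
  assumes col: "face_coloring H FH c" and i: "i \<in> {1..4}"
  shows "face_coloring (Qts i) (Fts i) (\<lambda>e. c (into_H x i ` e))"
proof -
  interpret labelled_factor "Qs i" "Fs i" "x i" "z i" using factors[OF i] .
  have image: "(\<lambda>e. c (into_H x i ` e)) ` star (Fts i) (Old v) = c ` star FH (Copy i v)" for v
    unfolding star_FH_Copy[OF i] by (simp add: image_image)
  have "card (c ` star FH (Copy i u)) = 2 \<and> c ` star FH (Copy i u) = c ` star FH (Copy i v)"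
    if "{u, v} \<in> inner i" for u v
  proof -
    have "{Copy i u, Copy i v} \<in> edges H - edges FH" using inner_edge_H[OF i that] by simp
    then show ?thesis using col unfolding face_coloring_def by blast
  qed
  then show ?thesis unfolding face_coloring_tilde_iff image by blast
qed

text \<open>Treats \<open>Vp\<close> and \<open>Vq\<close> alike: \<open>I\<close> holds the two
  copies whose half-edge \<open>e_j\<close> ends at \<open>w\<close>.\<close>

lemma star_FH_apex:
  assumes w: "\<And>i t. into_H x i t = w \<longleftrightarrow> t = Y j \<and> i \<in> I" and I: "I \<subseteq> {1..4}" and j: "j \<in> {1..6}"
  shows "star FH w = (\<lambda>i. into_H x i ` half_edge (x i) j) ` I"
proof (intro equalityI subsetI)
  fix e assume "e \<in> star FH w"
  then obtain i g where g: "g \<in> edges (Fts i)" "e = into_H x i ` g" and "w \<in> e"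
    unfolding star_def edges_factor_F by blast
  then obtain t where "t \<in> g" "into_H x i t = w" by blast
  then have "Y j \<in> g" "i \<in> I" unfolding w by simp_all
  then have "g = half_edge (x i) j" using g(1) unfolding edges_A_tilde by blast
  then show "e \<in> (\<lambda>i. into_H x i ` half_edge (x i) j) ` I" using g(2) \<open>i \<in> I\<close> by blast
next
  fix e assume "e \<in> (\<lambda>i. into_H x i ` half_edge (x i) j) ` I"
  then obtain i where i: "i \<in> I" "e = into_H x i ` half_edge (x i) j" by blast
  have "half_edge (x i) j \<in> edges (Fts i)" using j unfolding edges_A_tilde by blast
  then have "e \<in> edges FH" using i I unfolding edges_factor_F by blast
  moreover have "into_H x i (Y j) = w" using w i(1) by blast
  then have "w \<in> e" using i(2) by blast
  ultimately show "e \<in> star FH w" by (simp add: star_def)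
qed

lemma star_FH_Vp: "star FH Vp = {into_H x 1 ` half_edge (x 1) 2, into_H x 3 ` half_edge (x 3) 2}"
  using star_FH_apex[of Vp 2 "{1, 3}"] into_H_eq_Vp[of x] by simp

lemma star_FH_Vq: "star FH Vq = {into_H x 2 ` half_edge (x 2) 3, into_H x 4 ` half_edge (x 4) 3}"
  using star_FH_apex[of Vq 3 "{2, 4}"] into_H_eq_Vq[of x] by simp

lemma glued:
  assumes "((i, j), (k, l)) \<in> set gluing"
  shows "into_H x i ` half_edge (x i) j = into_H x k ` half_edge (x k) l"
  using assms unfolding into_H_image_half_edge
  by (simp add: gluing_def, elim disjE) (simp_all add: partner_def gluing_def insert_commute)

lemma no_face_coloring_H:
  assumes "\<And>i. i \<in> {1..4} \<Longrightarrow> \<not> contained_in_some_cdc (Qs i) (Fs i)"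
  shows "\<not> face_coloring H FH c"
proof
  assume col: "face_coloring H FH c"
  define k where "k i j = c (into_H x i ` half_edge (x i) j)" for i j
  have adm: "admissible (k i 1) (k i 2) (k i 3) (k i 4) (k i 5) (k i 6)" if i: "i \<in> {1..4}" for i
  proof -
    interpret labelled_factor "Qs i" "Fs i" "x i" "z i" using factors[OF i] .
    note c = face_coloring_Qt[OF col i]
    show ?thesis
    proof (rule admissible_half_edge_colors)
      show "even (card {j \<in> {1..6}. k i j = a})" for a
        using even_color_class[OF c, of a] unfolding k_def .
      show "k i 2 \<noteq> k i 3" using half_edges_2_3_neq[OF c] unfolding k_def .
      show "{t, k i 6} \<noteq> {k i 4, k i 5}" if "{k i 1, t} = {k i 2, k i 3}" "t \<noteq> k i 6" for t
        using contained_if_tilde_coloring[OF c, of t] assms[OF i] that unfolding k_def by blast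
    qed
  qed
  have "card (c ` star FH Vp) = 2" "c ` star FH Vp = c ` star FH Vq"
    using col PQ_edge unfolding face_coloring_def by blast+
  then have pq: "card {k 1 2, k 3 2} = 2" "{k 1 2, k 3 2} = {k 2 3, k 4 3}"
    unfolding star_FH_Vp star_FH_Vq by (simp_all add: k_def)
  have p: "k 1 2 \<noteq> k 3 2" using pq(1) by auto
  have g: "k i j = k i' j'" if "((i, j), (i', j')) \<in> set gluing" for i j i' j'
    unfolding k_def glued[OF that] ..
  \<comment> \<open>Oriented so that the colours of \<open>e_4\<close> and \<open>e_5\<close> are
    named by the copy they are glued to, and those of \<open>e_6\<close> by copies 1 and 2.\<close>
  have eqs: "k 4 4 = k 1 1" "k 4 5 = k 1 3" "k 3 4 = k 4 1" "k 3 5 = k 4 2" "k 2 4 = k 3 1"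
    "k 2 5 = k 3 3" "k 1 4 = k 2 1" "k 1 5 = k 2 2" "k 3 6 = k 1 6" "k 4 6 = k 2 6"
    by (rule g[symmetric], simp add: gluing_def)+
  have "admissible (k 1 1) (k 1 2) (k 1 3) (k 2 1) (k 2 2) (k 1 6)"
    "admissible (k 4 1) (k 4 2) (k 4 3) (k 1 1) (k 1 3) (k 2 6)"
    "admissible (k 3 1) (k 3 2) (k 3 3) (k 4 1) (k 4 2) (k 1 6)"
    "admissible (k 2 1) (k 2 2) (k 2 3) (k 3 1) (k 3 3) (k 2 6)"
    using adm[of 1] adm[of 2] adm[of 3] adm[of 4] unfolding eqs by simp_all
  then show False using p pq(2) by (rule admissible_gluing_contradiction)
qed

end

section \<open>From the labelled permutation snarks to the conclusion\<close>

lemma labelled_factorI: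
  assumes "cubic Q" "permutation_two_factor Q F" "components F = {C1, C2}"
    and "path_in C1 [x 1, x 2, z 2, x 6]" "path_in C2 [x 4, z 1, x 5]" "{z 1, z 2} \<in> edges Q"
  shows "labelled_factor Q F x z"
proof -
  have tf: "two_factor Q F" and ne: "C1 \<noteq> C2"
    using assms(2,3) by (auto simp: permutation_two_factor_def doubleton_eq_iff)
  then have sub: "subgraph F Q" and simple: "simple_graph F"
    by (auto simp: two_factor_def regular_def)
  then have pg: "pair_graph F" by (simp add: simple_graph_pair_graph)
  have comp: "C1 \<in> components F" "C2 \<in> components F" using assms(3) by auto
  then have edges: "edges C1 \<subseteq> edges F" "edges C2 \<subseteq> edges F" by (auto simp: components_def subgraph_def)
  have in1: "x 1 \<in> verts C1" "x 2 \<in> verts C1" "z 2 \<in> verts C1" "x 6 \<in> verts C1"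
    and d1: "distinct [x 1, x 2, z 2, x 6]" and e1: "{x 1, x 2} \<in> edges F" "{x 2, z 2} \<in> edges F" "{z 2, x 6} \<in> edges F"
    using assms(4) edges by (auto simp: path_in_def)
  have in2: "x 4 \<in> verts C2" "z 1 \<in> verts C2" "x 5 \<in> verts C2"
    and d2: "distinct [x 4, z 1, x 5]" and e2: "{x 4, z 1} \<in> edges F" "{z 1, x 5} \<in> edges F"
    using assms(5) edges by (auto simp: path_in_def)
  \<comment> \<open>Distinct components are disjoint. This separates the vertices of the two paths
    and keeps \<open>{z 1, z 2}\<close>, which joins the two circuits, out of
    \<open>F\<close>.\<close>
  have disj: "verts C1 \<inter> verts C2 = {}"
    using components_eq_component_of[OF pg] comp ne by blast
  have "{z 1, z 2} \<notin> edges F"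
  proof
    assume e: "{z 1, z 2} \<in> edges F"
    have "C1 = component_of F (z 2)" using components_eq_component_of[OF pg comp(1) in1(3)] .
    moreover have "(z 2, z 1) \<in> adj F" using e by (simp add: adj_def insert_commute)
    ultimately have "z 1 \<in> verts C1" by (auto simp: component_of_def)
    with in2(2) disj show False by blast
  qed
  moreover have "distinct [x 1, x 2, z 2, x 6, x 4, z 1, x 5]"
    using d1 d2 in1 in2 disj by auto
  ultimately show ?thesis
    using assms(1,6) tf e1 e2 by unfold_locales auto
qed

theorem theorem2p16:
  fixes Qs Fs C1 C2 :: "nat \<Rightarrow> 'a graph"
    and x z :: "nat \<Rightarrow> nat \<Rightarrow> 'a"
    and S :: "'a hvertex graph set"
  assumes "\<forall>i\<in>{1..4}. permutation_snark (Qs i) \<and> cyclically_edge_connected 5 (Qs i)"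
    and "\<forall>i\<in>{1..4}. permutation_two_factor (Qs i) (Fs i) \<and> components (Fs i) = {C1 i, C2 i}"
    and "\<forall>i\<in>{1..4}. \<not> contained_in_some_cdc (Qs i) (Fs i)"
    and "\<forall>i\<in>{1..4}. path_in (C1 i) [x i 1, x i 2, z i 2, x i 6]"
    and "\<forall>i\<in>{1..4}. path_in (C2 i) [x i 4, z i 1, x i 5]"
    and "\<forall>i\<in>{1..4}. {z i 1, z i 2} \<in> edges (Qs i)"
    and "cdc (graph_H Qs x z) S"
  shows "factor_F Fs x z \<notin> S"
proof
  assume F: "factor_F Fs x z \<in> S"
  interpret superposition Qs Fs x z
  proof (rule superposition.intro)
    fix i :: nat assume i: "i \<in> {1..4}"
    have "cubic (Qs i)" using assms(1) i by (auto simp: permutation_snark_def snark_def)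
    then show "labelled_factor (Qs i) (Fs i) (x i) (z i)"
      using assms(2,4-6) i by (intro labelled_factorI[of _ _ "C1 i" "C2 i"]) auto
  qed
  obtain c :: "'a hvertex set \<Rightarrow> 'a hvertex graph" where "face_coloring H FH c"
    using face_coloring_H[OF assms(7) F] .
  then show False using no_face_coloring_H assms(3) by blast
qed

end
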